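(* Let $M$ be a homogeneous hypersurface of ${\rm Sol}_0^4$. Then, up to isometries of ${\rm Sol}_0^4$, one of the following four cases occurs: (1) $M$ is $M_{1,r}=\{(e^{x_3}\cos x_1\tanh r,\ e^{x_3}\sin x_1\tanh r,\ x_2,\ x_3+\ln(\operatorname{sech} r))\mid x_1,x_2,x_3\in\mathbb{R}\}$ for some $r>0$, which is an orbit through $(\tanh r,0,0,\ln(\operatorname{sech} r))$ of the subgroup $\{(0,0,z,t)\in{\rm Sol}_0^4\mid z,t\in\mathbb{R}\}\times{\rm SO}(2)\cong(\mathbb{R}\rtimes_{\theta_1}\mathbb{R})\times{\rm SO}(2)$, where $\theta_1(t)=e^{-2t}$; (2) $M$ is $M_{2,r}=\{(x_1,\ e^{x_3}\tanh r,\ x_2,\ x_3+\ln(\operatorname{sech} r))\mid x_1,x_2,x_3\in\mathbb{R}\}$ for some $r\ge0$, which is an orbit through $(0,\tanh r,0,\ln(\operatorname{sech} r))$ of the subgroup $\{(x,0,z,t)\in{\rm Sol}_0^4\mid x,z,t\in\mathbb{R}\}\cong\mathbb{R}^2\rtimes_{\theta_2}\mathbb{R}$, where $\theta_2(t)=\begin{pmatrix}e^t&0\\0&e^{-2t}\end{pmatrix}$; (3) $M$ is $M_{3,r}=\{(x_1,\ x_2,\ \tfrac12e^{-2x_3}\tanh(2r),\ x_3+\tfrac12\ln(\cosh(2r)))\mid x_1,x_2,x_3\in\mathbb{R}\}$ for some $r\ge0$, which is an orbit through $(0,0,\tfrac12\tanh(2r),\tfrac12\ln(\cosh(2r)))$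 of the subgroup $\{(x,y,0,t)\in{\rm Sol}_0^4\mid x,y,t\in\mathbb{R}\}\cong\mathbb{R}^2\rtimes_{\theta_3}\mathbb{R}$, where $\theta_3(t)=\begin{pmatrix}e^t&0\\0&e^t\end{pmatrix}$; (4) $M$ is $M_{4,0}=\{(x,y,z,0)\mid x,y,z\in\mathbb{R}\}$, which is an orbit through $(0,0,0,0)$ of the subgroup $\{(x,y,z,0)\in{\rm Sol}_0^4\mid x,y,z\in\mathbb{R}\}\cong\mathbb{R}^3$.
   Context: ${\rm Sol}_0^4$ is the Lie group $\mathbb{R}^4=\{(x,y,z,t)\}$ with product $(\tilde x,\tilde y,\tilde z,\tilde t)\cdot(x,y,z,t)=(\tilde x+e^{\tilde t}x,\tilde y+e^{\tilde t}y,\tilde z+e^{-2\tilde t}z,\tilde t+t)$, equipped with the left invariant Riemannian metric $g=e^{-2t}(dx^2+dy^2)+e^{4t}dz^2+dt^2$. The isometry group of ${\rm Sol}_0^4$ is taken to be ${\rm Sol}_0^4\rtimes({\rm O}(2)\times\mathbb{Z}_2)$, where ${\rm Sol}_0^4$ acts by left translations, ${\rm O}(2)$ acts by rotations and reflections in the $xy$-plane, and $\mathbb{Z}_2$ acts by the reflection $z\mapsto -z$. Subsets of ${\rm Sol}_0^4$ that are subgroups act by left translations, and in (1) ${\rm SO}(2)$ acts by rotations in the $xy$-plane. A hypersurface $M$ of a Riemannian manifold $\widetilde M$ is called homogeneous if there is a closed subgroup $G$ of the isometry group of $\widetilde M$ such that $M=G\cdot p=\{g\cdot p\mid g\in G\}$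 for some $p\in M$. "Up to isometries" means after applying an isometry of ${\rm Sol}_0^4$ to $M$.
   Formalization: The hypersurface M is assumed connected; otherwise the claim fails: the closed subgroup {(x,y,z,n) : n an integer} has as an orbit the union of the slices t = n, a disconnected hypersurface that is none of the four (connected) cases. *)

theory Defs
  imports "HOL-Analysis.Analysis" "HOL-Algebra.Group_Action"
begin

section \<open>Smooth maps, hypersurfaces, isomorphisms of Lie groups\<close>

text \<open>
  Meant for open \<open>U\<close>, where it says that all iterated directional derivatives up to
  order \<open>k\<close> exist and are continuous.
\<close>

primrec Ck_on :: "nat \<Rightarrow> ('a::real_normed_vector \<Rightarrow> 'b::real_normed_vector) \<Rightarrow> 'a set \<Rightarrow> bool" where
  "Ck_on 0 f U \<longleftrightarrow> continuous_on U f"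
| "Ck_on (Suc k) f U \<longleftrightarrow>
     (\<forall>x\<in>U. f differentiable (at x)) \<and> (\<forall>v. Ck_on k (\<lambda>x. frechet_derivative f (at x) v) U)"

definition smooth_open :: "('a::real_normed_vector \<Rightarrow> 'b::real_normed_vector) \<Rightarrow> 'a set \<Rightarrow> bool" where
  "smooth_open f U \<longleftrightarrow> open U \<and> (\<forall>k. Ck_on k f U)"

text \<open>
  Smoothness on an arbitrary subset: local extendability to smooth maps on open sets. On an
  embedded submanifold this is smoothness for the induced smooth structure.
\<close>

definition smooth_map_on :: "('a::real_normed_vector \<Rightarrow> 'b::real_normed_vector) \<Rightarrow> 'a set \<Rightarrow> bool" where
  "smooth_map_on f S \<longleftrightarrow>
     (\<forall>x\<in>S. \<exists>U F. x \<in> U \<and> smooth_open F U \<and> (\<forall>y\<in>S \<inter> U. F y = f y))"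

text \<open>
  Lie groups occurring below are groups whose carrier is an embedded submanifold of a normed
  vector space; an isomorphism is a group isomorphism that is a diffeomorphism.
\<close>

definition lie_isomorphic ::
  "'a::real_normed_vector monoid \<Rightarrow> 'b::real_normed_vector monoid \<Rightarrow> bool" (infix \<open>\<cong>\<^sub>L\<close> 50) where
  "G \<cong>\<^sub>L H \<longleftrightarrow>
     (\<exists>f\<in>iso G H. smooth_map_on f (carrier G) \<and> smooth_map_on (inv_into (carrier G) f) (carrier H))"


section \<open>The Lie group and its metric\<close>

type_synonym R4 = "real \<times> real \<times> real \<times> real"

text \<open>Connected embedded submanifolds of dimension three, given by slice charts.\<close>

definition hypersurface :: "R4 set \<Rightarrow> bool" where
  "hypersurface M \<longleftrightarrow> connected M \<and> M \<noteq> {} \<and>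
     (\<forall>p\<in>M. \<exists>U V (\<phi> :: R4 \<Rightarrow> R4) (\<psi> :: R4 \<Rightarrow> R4). p \<in> U \<and> smooth_open \<phi> U \<and> smooth_open \<psi> V \<and> homeomorphism U V \<phi> \<psi> \<and>
        \<phi> ` (M \<inter> U) = V \<inter> {(a, b, c, d). d = 0})"

fun sol_mult :: "R4 \<Rightarrow> R4 \<Rightarrow> R4" where
  "sol_mult (x', y', z', t') (x, y, z, t) =
     (x' + exp t' * x, y' + exp t' * y, z' + exp (-2 * t') * z, t' + t)"

definition Sol04 :: "R4 monoid" where
  "Sol04 = \<lparr>carrier = UNIV, mult = sol_mult, one = (0, 0, 0, 0)\<rparr>"

fun sol_metric :: "R4 \<Rightarrow> R4 \<Rightarrow> R4 \<Rightarrow> real" where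
  "sol_metric (x, y, z, t) (u1, u2, u3, u4) (v1, v2, v3, v4) =
     exp (-2 * t) * (u1 * v1 + u2 * v2) + exp (4 * t) * (u3 * v3) + u4 * v4"


section \<open>The isometry group\<close>

text \<open>
  A triple \<open>(a, A, \<epsilon>)\<close> stands for the isometry \<open>p \<mapsto> a \<cdot> (A, \<epsilon>) p\<close>, where the orthogonal
  matrix \<open>A\<close> acts on the \<open>xy\<close>-plane and \<open>\<epsilon> = 1, -1\<close> on the \<open>z\<close>-axis. The topology of the
  isometry group is the one induced from the ambient product space.
\<close>

type_synonym sol_isometry = "R4 \<times> (real^2^2) \<times> real"

fun sol_aut :: "(real^2^2) \<Rightarrow> real \<Rightarrow> R4 \<Rightarrow> R4" where
  "sol_aut A \<epsilon> (x, y, z, t) =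
     ((A *v vector [x, y]) $ 1, (A *v vector [x, y]) $ 2, \<epsilon> * z, t)"

fun isom_act :: "sol_isometry \<Rightarrow> R4 \<Rightarrow> R4" where
  "isom_act (a, A, \<epsilon>) p = sol_mult a (sol_aut A \<epsilon> p)"

fun isom_mult :: "sol_isometry \<Rightarrow> sol_isometry \<Rightarrow> sol_isometry" where
  "isom_mult (a, A, \<epsilon>) (b, B, \<delta>) = (sol_mult a (sol_aut A \<epsilon> b), A ** B, \<epsilon> * \<delta>)"

definition Isom :: "sol_isometry monoid" where
  "Isom = \<lparr>carrier = UNIV \<times> {A. orthogonal_matrix A} \<times> {1, -1},
           mult = isom_mult, one = ((0, 0, 0, 0), mat 1, 1)\<rparr>"

abbreviation isom_orbit :: "sol_isometry set \<Rightarrow> R4 \<Rightarrow> R4 set" where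
  "isom_orbit G p \<equiv> Group_Action.orbit (Isom\<lparr>carrier := G\<rparr>) isom_act p"

definition left_translations :: "R4 set \<Rightarrow> sol_isometry set" where
  "left_translations H = (\<lambda>a. (a, mat 1, 1)) ` H"

definition homogeneous_hypersurface :: "R4 set \<Rightarrow> bool" where
  "homogeneous_hypersurface M \<longleftrightarrow> hypersurface M \<and>
     (\<exists>G. subgroup G Isom \<and> closedin (top_of_set (carrier Isom)) G \<and>
        (\<exists>p\<in>M. M = isom_orbit G p))"


section \<open>The groups and hypersurfaces of the classification\<close>

definition semidirect_real :: "(real \<Rightarrow> 'v \<Rightarrow> 'v) \<Rightarrow> ('v::real_vector \<times> real) monoid" where
  "semidirect_real \<theta> =
     \<lparr>carrier = UNIV, mult = (\<lambda>(v, s) (w, t). (v + \<theta> s w, s + t)), one = (0, 0)\<rparr>"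

definition \<theta>1 :: "real \<Rightarrow> real" where
  "\<theta>1 t = exp (-2 * t)"

definition \<theta>2 :: "real \<Rightarrow> (real^2^2)" where
  "\<theta>2 t = vector [vector [exp t, 0], vector [0, exp (-2 * t)]]"

definition \<theta>3 :: "real \<Rightarrow> (real^2^2)" where
  "\<theta>3 t = vector [vector [exp t, 0], vector [0, exp t]]"

definition SO2 :: "(real^2^2) monoid" where
  "SO2 = \<lparr>carrier = {A. rotation_matrix A}, mult = (**), one = mat 1\<rparr>"

definition additive_R3 :: "(real^3) monoid" where
  "additive_R3 = \<lparr>carrier = UNIV, mult = (+), one = 0\<rparr>"

definition H1 :: "sol_isometry set" where
  "H1 = {((0, 0, z, t), A, 1) | z t A. rotation_matrix A}"

definition H2 :: "R4 set" where
  "H2 = {(x, 0, z, t) | x z t. True}"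

definition H3 :: "R4 set" where
  "H3 = {(x, y, 0, t) | x y t. True}"

definition H4 :: "R4 set" where
  "H4 = {(x, y, z, 0) | x y z. True}"

definition sech :: "real \<Rightarrow> real" where
  "sech r = 1 / cosh r"

definition M1 :: "real \<Rightarrow> R4 set" where
  "M1 r = {(exp x3 * cos x1 * tanh r, exp x3 * sin x1 * tanh r, x2, x3 + ln (sech r))
           | x1 x2 x3. True}"

definition M2 :: "real \<Rightarrow> R4 set" where
  "M2 r = {(x1, exp x3 * tanh r, x2, x3 + ln (sech r)) | x1 x2 x3. True}"

definition M3 :: "real \<Rightarrow> R4 set" where
  "M3 r = {(x1, x2, 1/2 * exp (-2 * x3) * tanh (2 * r), x3 + 1/2 * ln (cosh (2 * r)))
           | x1 x2 x3. True}"

definition M40 :: "R4 set" where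
  "M40 = {(x, y, z, 0) | x y z. True}"


section \<open>Consistency of the encoding\<close>

lemma sol_mult_assoc: "sol_mult (sol_mult a b) c = sol_mult a (sol_mult b c)"
  by (cases a; cases b; cases c) (simp add: algebra_simps exp_add exp_diff exp_minus field_simps)

lemma group_Sol04: "group Sol04"
proof (rule groupI)
  fix a b c :: R4
  show "a \<otimes>\<^bsub>Sol04\<^esub> b \<otimes>\<^bsub>Sol04\<^esub> c = a \<otimes>\<^bsub>Sol04\<^esub> (b \<otimes>\<^bsub>Sol04\<^esub> c)"
    by (simp add: Sol04_def sol_mult_assoc)
  show "\<one>\<^bsub>Sol04\<^esub> \<otimes>\<^bsub>Sol04\<^esub> a = a"
    by (cases a) (simp add: Sol04_def)
  obtain x y z t where a: "a = (x, y, z, t)" by (cases a)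
  have "(- exp (-t) * x, - exp (-t) * y, - exp (2 * t) * z, -t) \<otimes>\<^bsub>Sol04\<^esub> a = \<one>\<^bsub>Sol04\<^esub>"
    by (simp add: Sol04_def a)
  then show "\<exists>b\<in>carrier Sol04. b \<otimes>\<^bsub>Sol04\<^esub> a = \<one>\<^bsub>Sol04\<^esub>"
    by (intro bexI) (simp_all add: Sol04_def)
qed (simp_all add: Sol04_def)

lemma sol_aut_hom: "sol_aut A \<epsilon> (sol_mult a b) = sol_mult (sol_aut A \<epsilon> a) (sol_aut A \<epsilon> b)"
  by (cases a; cases b) (simp add: matrix_vector_mult_def sum_2 algebra_simps)

lemma sol_aut_comp: "sol_aut A \<epsilon> (sol_aut B \<delta> p) = sol_aut (A ** B) (\<epsilon> * \<delta>) p"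
  by (cases p) (simp add: matrix_vector_mult_def matrix_matrix_mult_def sum_2 algebra_simps)

lemma sol_aut_one: "sol_aut (mat 1) 1 p = p"
  by (cases p) simp

lemma isom_act_mult: "isom_act (isom_mult g h) p = isom_act g (isom_act h p)"
  by (cases g; cases h) (simp add: sol_aut_hom sol_aut_comp sol_mult_assoc)

lemma isom_act_one: "isom_act ((0, 0, 0, 0), mat 1, 1) p = p"
  by (cases p) simp

lemma group_Isom: "group Isom"
proof (rule groupI)
  fix g h k
  assume "g \<in> carrier Isom" "h \<in> carrier Isom"
  then show "g \<otimes>\<^bsub>Isom\<^esub> h \<in> carrier Isom"
    by (auto simp: Isom_def orthogonal_matrix_mul)
  show "g \<otimes>\<^bsub>Isom\<^esub> h \<otimes>\<^bsub>Isom\<^esub> k = g \<otimes>\<^bsub>Isom\<^esub> (h \<otimes>\<^bsub>Isom\<^esub> k)"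
    by (cases g; cases h; cases k)
      (simp add: Isom_def sol_aut_hom sol_aut_comp sol_mult_assoc matrix_mul_assoc)
  show "\<one>\<^bsub>Isom\<^esub> \<otimes>\<^bsub>Isom\<^esub> g = g"
    by (cases g) (auto simp: Isom_def sol_aut_one)
next
  show "\<one>\<^bsub>Isom\<^esub> \<in> carrier Isom"
    by (simp add: Isom_def orthogonal_matrix_id)
next
  fix g assume g: "g \<in> carrier Isom"
  obtain a A \<epsilon> where g_eq: "g = (a, A, \<epsilon>)" by (cases g)
  with g have A: "orthogonal_matrix A" and \<epsilon>: "\<epsilon> = 1 \<or> \<epsilon> = -1"
    by (auto simp: Isom_def)
  obtain b where b: "sol_mult b (sol_aut (transpose A) \<epsilon> a) = (0, 0, 0, 0)"
    using group.l_inv_ex[OF group_Sol04, of "sol_aut (transpose A) \<epsilon> a"]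
    by (auto simp: Sol04_def)
  show "\<exists>h\<in>carrier Isom. h \<otimes>\<^bsub>Isom\<^esub> g = \<one>\<^bsub>Isom\<^esub>"
  proof (rule bexI[of _ "(b, transpose A, \<epsilon>)"])
    show "(b, transpose A, \<epsilon>) \<otimes>\<^bsub>Isom\<^esub> g = \<one>\<^bsub>Isom\<^esub>"
      using A \<epsilon> b by (auto simp: Isom_def g_eq orthogonal_matrix)
    show "(b, transpose A, \<epsilon>) \<in> carrier Isom"
      using A \<epsilon> by (auto simp: Isom_def orthogonal_matrix_transpose)
  qed
qed

lemma isom_act_isometry:
  assumes "g \<in> carrier Isom"
  shows "\<exists>D. (isom_act g has_derivative D) (at p) \<and>
           (\<forall>u v. sol_metric (isom_act g p) (D u) (D v) = sol_metric p u v)"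
proof -
  obtain a1 a2 a3 s A \<epsilon> where g: "g = ((a1, a2, a3, s), A, \<epsilon>)" by (cases g) auto
  from assms have A: "orthogonal_matrix A" and \<epsilon>: "\<epsilon> * \<epsilon> = 1"
    by (auto simp: Isom_def g)
  obtain x y z t where p: "p = (x, y, z, t)" by (cases p)
  define D :: "R4 \<Rightarrow> R4" where "D = (\<lambda>u.
      (exp s * (A $ 1 $ 1 * fst u + A $ 1 $ 2 * fst (snd u)),
       exp s * (A $ 2 $ 1 * fst u + A $ 2 $ 2 * fst (snd u)),
       exp (-2 * s) * (\<epsilon> * fst (snd (snd u))), snd (snd (snd u))))"
  have act: "isom_act g = (\<lambda>u. (a1, a2, a3, s) + D u)"
    by (auto simp: fun_eq_iff g D_def matrix_vector_mult_def sum_2)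
  have "bounded_linear D"
    unfolding D_def by (intro linear_conv_bounded_linear[THEN iffD1] linearI)
      (auto simp: algebra_simps)
  then have "(isom_act g has_derivative D) (at p)"
    unfolding act by (auto intro!: derivative_eq_intros bounded_linear_imp_has_derivative)
  moreover have "sol_metric (isom_act g p) (D u) (D v) = sol_metric p u v" for u v
  proof -
    have "transpose A ** A = mat 1"
      using A by (simp add: orthogonal_matrix)
    then have "(transpose A ** A) $ i $ j = mat 1 $ i $ j" for i j
      by simp
    note this[of 1 1] this[of 1 2] this[of 2 2]
    then have o: "A$1$1 * A$1$1 + A$2$1 * A$2$1 = 1" "A$1$1 * A$1$2 + A$2$1 * A$2$2 = 0"
      "A$1$2 * A$1$2 + A$2$2 * A$2$2 = 1"
      by (simp_all add: matrix_matrix_mult_def transpose_def mat_def sum_2)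
    obtain u1 u2 u3 u4 where u: "u = (u1, u2, u3, u4)" by (cases u)
    obtain v1 v2 v3 v4 where v: "v = (v1, v2, v3, v4)" by (cases v)
    have e1: "exp (-2 * (s + t)) * (exp s * exp s) = exp (-2 * t)"
      by (simp add: exp_add[symmetric])
    have e2: "exp (4 * (s + t)) * (exp (-2 * s) * exp (-2 * s)) = exp (4 * t)"
      by (simp add: exp_add[symmetric])
    have xy: "(A$1$1 * u1 + A$1$2 * u2) * (A$1$1 * v1 + A$1$2 * v2) +
        (A$2$1 * u1 + A$2$2 * u2) * (A$2$1 * v1 + A$2$2 * v2) = u1 * v1 + u2 * v2"
      (is "?l = _")
    proof -
      have "?l = (A$1$1 * A$1$1 + A$2$1 * A$2$1) * (u1 * v1) +
          (A$1$1 * A$1$2 + A$2$1 * A$2$2) * (u1 * v2 + u2 * v1) +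
          (A$1$2 * A$1$2 + A$2$2 * A$2$2) * (u2 * v2)"
        by (simp add: algebra_simps)
      then show ?thesis by (simp add: o)
    qed
    have "sol_metric (isom_act g p) (D u) (D v) =
        (exp (-2 * (s + t)) * (exp s * exp s)) *
          ((A$1$1 * u1 + A$1$2 * u2) * (A$1$1 * v1 + A$1$2 * v2) +
           (A$2$1 * u1 + A$2$2 * u2) * (A$2$1 * v1 + A$2$2 * v2)) +
        (exp (4 * (s + t)) * (exp (-2 * s) * exp (-2 * s))) * ((\<epsilon> * \<epsilon>) * (u3 * v3)) + u4 * v4"
      unfolding g p u v D_def by (simp only: isom_act.simps sol_aut.simps sol_mult.simps
          sol_metric.simps fst_conv snd_conv) (simp add: algebra_simps)
    then show ?thesis
      unfolding e1 e2 xy \<epsilon> by (simp add: p u v)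
  qed
  ultimately show ?thesis by blast
qed

end

theory Submission
  imports Defs
begin

text \<open>
  Move a point of \<open>M\<close> to the origin by a left translation, so that \<open>M\<close> is the orbit of the origin
  under a closed subgroup \<open>G\<close> of the isometry group, and let \<open>L\<close> be the set of all vectors of the
  Lie algebra whose one-parameter group lies in \<open>G\<close>. Since \<open>G\<close> is closed and the isotropy groups are
  compact, \<open>L\<close> is a Lie subalgebra, and every vector tangent to \<open>M\<close> at the origin is the velocity of
  some one-parameter group in \<open>G\<close>. Hence \<open>L\<close> projects onto a hyperplane of the tangent space.
  Together with closedness under brackets this leaves four cases: \<open>L\<close> contains the
  \<open>xy\<close>-translations and a vector over \<open>\<partial>z\<close> or one with non-zero \<open>t\<close>-component, or it contains the
  \<open>z\<close>-translations, a vector over \<open>\<partial>t\<close>, and either one horizontal translation or the rotation fixing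
  the same horizontal point as that vector. In each case \<open>M\<close> contains an isometric copy of one of the
  closed model hypersurfaces; a closed hypersurface contained in \<open>M\<close> is also open in \<open>M\<close> by
  invariance of domain, so it is all of \<open>M\<close>.
\<close>


section \<open>One-parameter groups of isometries\<close>

text \<open>A tangent vector determines an infinitesimal isometry only up to its angular velocity,
  because the isotropy group of a point contains rotations. Statements that produce elements of
  \<open>lie\<close> from tangent vectors therefore carry an unknown last component, and controlling
  it is the main difficulty: in the limits, since the angles of the approximating isometries may
  tend to 0 arbitrarily slowly, and in the algebra. There it helps that a vector with components d,
  l acts on horizontal translations as multiplication by the complex number d + i l, so one
  horizontal translation and one nonzero angular velocity already generate the whole plane. The case
  split asks whether this happens. A rotation-free vector with t-component 1 has weight 1 on the
  plane and -2 on the z-axis, so brackets with it separate these directions. The function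
  \<open>exprel\<close> enters because a one-parameter group with growth rate c is displaced, after
  unit time, by its initial velocity times the integral of exp (s c) over s from 0 to 1, and this
  integral is \<open>exprel c\<close>.\<close>

definition exprel :: "'a::{real_normed_field,banach} \<Rightarrow> 'a" where
  "exprel c = (if c = 0 then 1 else (exp c - 1) / c)"

lemma mult_exprel: "c * exprel c = exp c - 1"
  by (simp add: exprel_def)

lemma exprel_0 [simp]: "exprel 0 = 1"
  by (simp add: exprel_def)

lemma isCont_exprel: "isCont exprel (c :: 'a::{real_normed_field,banach})"
proof (cases "c = 0")
  case True
  have "((\<lambda>y. (exp y - exp 0) / (y - 0)) \<longlongrightarrow> exp (0 :: 'a)) (at 0)"
    using DERIV_exp[of "0 :: 'a"] by (simp only: has_field_derivative_iff)
  then have "((\<lambda>y. (exp y - 1) / y) \<longlongrightarrow> (1 :: 'a)) (at 0)"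
    by simp
  then have "(exprel \<longlongrightarrow> (1 :: 'a)) (at 0)"
    by (rule Lim_transform_eventually) (auto simp: eventually_at_filter exprel_def)
  then show ?thesis
    using True by (simp add: isCont_def)
next
  case False
  have "isCont (\<lambda>y. (exp y - 1) / y) c"
    using False by (intro continuous_intros) auto
  moreover have "eventually (\<lambda>y. y \<noteq> 0) (nhds c)"
    using False by (rule t1_space_nhds)
  then have "\<forall>\<^sub>F y in nhds c. exprel y = (exp y - 1) / y"
    by eventually_elim (simp add: exprel_def)
  ultimately show ?thesis
    by (simp add: isCont_cong)
qed

lemma tendsto_exprel [tendsto_intros]:
  fixes c :: "'a::{real_normed_field,banach}"
  shows "(f \<longlongrightarrow> c) F \<Longrightarrow> ((\<lambda>x. exprel (f x)) \<longlongrightarrow> exprel c) F"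
  by (rule isCont_tendsto_compose[OF isCont_exprel])

text \<open>Stated as a product, so that the removable singularity at \<open>c = 0\<close> needs no side condition.\<close>

lemma sum_exp_exprel:
  fixes c :: "'a::{real_normed_field,banach}"
  shows "(\<Sum>j<k. exp c ^ j) * exprel c = of_nat k * exprel (of_nat k * c)"
proof (cases "c = 0")
  case False
  have "c * ((\<Sum>j<k. exp c ^ j) * exprel c) = exp c ^ k - 1"
    by (simp add: mult.left_commute[of c] mult_exprel power_diff_1_eq mult.commute)
  also have "\<dots> = c * (of_nat k * exprel (of_nat k * c))"
    using mult_exprel[of "of_nat k * c"] by (simp add: mult_ac flip: exp_of_nat_mult)
  finally show ?thesis
    using False by simp
qed simp

text \<open>The sequence is a translation component of the \<open>k n\<close>-th power of a small
  motion. By \<open>sum_exp_exprel\<close> it equals k w' exprel (k c') / exprel c', and the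
  denominator tends to 1 because \<open>c'\<close> tends to 0.\<close>

lemma tendsto_geometric_exprel:
  fixes c w :: "'a::{real_normed_field,banach}"
  assumes "(\<lambda>n. of_nat (k n) * w' n) \<longlonglongrightarrow> w" "(\<lambda>n. of_nat (k n) * c' n) \<longlonglongrightarrow> c" "c' \<longlonglongrightarrow> 0"
  shows "(\<lambda>n. w' n * (\<Sum>j<k n. exp (c' n) ^ j)) \<longlonglongrightarrow> w * exprel c"
proof -
  have 1: "(\<lambda>n. exprel (c' n)) \<longlonglongrightarrow> 1"
    using tendsto_exprel[OF assms(3)] by simp
  have "(\<lambda>n. of_nat (k n) * w' n * exprel (of_nat (k n) * c' n) / exprel (c' n)) \<longlonglongrightarrow> w * exprel c / 1"
    by (intro tendsto_intros assms 1) simp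
  moreover have "\<forall>\<^sub>F n in sequentially. exprel (c' n) \<noteq> 0"
    using tendsto_imp_eventually_ne[OF 1] by simp
  then have "\<forall>\<^sub>F n in sequentially.
      of_nat (k n) * w' n * exprel (of_nat (k n) * c' n) / exprel (c' n) = w' n * (\<Sum>j<k n. exp (c' n) ^ j)"
  proof eventually_elim
    case (elim n)
    then have "(\<Sum>j<k n. exp (c' n) ^ j) = of_nat (k n) * exprel (of_nat (k n) * c' n) / exprel (c' n)"
      by (subst nonzero_eq_divide_eq) (simp_all only: sum_exp_exprel not_False_eq_True)
    then show ?case by (simp only: times_divide_eq_right mult_ac)
  qed
  ultimately show ?thesis
    by (simp add: Lim_transform_eventually)
qed

section \<open>Rotations of the plane\<close>

definition rotm :: "real \<Rightarrow> real^2^2" where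
  "rotm \<theta> = vector [vector [cos \<theta>, - sin \<theta>], vector [sin \<theta>, cos \<theta>]]"

lemma rotm_nth [simp]:
  "rotm \<theta> $ 1 $ 1 = cos \<theta>" "rotm \<theta> $ 1 $ 2 = - sin \<theta>"
  "rotm \<theta> $ 2 $ 1 = sin \<theta>" "rotm \<theta> $ 2 $ 2 = cos \<theta>"
  by (simp_all add: rotm_def)

lemma matrix2_eq_iff:
  "(A :: 'a^2^2) = B \<longleftrightarrow> A$1$1 = B$1$1 \<and> A$1$2 = B$1$2 \<and> A$2$1 = B$2$1 \<and> A$2$2 = B$2$2"
  by (auto simp: vec_eq_iff forall_2)

lemma rotm_mult: "rotm a ** rotm b = rotm (a + b)"
  by (simp add: matrix2_eq_iff matrix_matrix_mult_def sum_2 cos_add sin_add)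

lemma rotm_0: "rotm 0 = mat 1"
  by (simp add: matrix2_eq_iff mat_def)

lemma rotation_matrix_rotm: "rotation_matrix (rotm \<theta>)"
  by (simp add: rotation_matrix_def orthogonal_matrix matrix2_eq_iff matrix_matrix_mult_def sum_2
      transpose_def mat_def det_2 flip: power2_eq_square)

lemma rotation_matrix_2_entries:
  assumes "rotation_matrix (A :: real^2^2)"
  shows "A$2$2 = A$1$1" "A$1$2 = - A$2$1" "A$1$1^2 + A$2$1^2 = 1"
proof -
  have "transpose A ** A = mat 1" "det A = 1"
    using assms by (auto simp: rotation_matrix_def orthogonal_matrix)
  then have *: "A$1$1 * A$1$1 + A$2$1 * A$2$1 = 1" "A$1$1 * A$1$2 + A$2$1 * A$2$2 = 0"
      "A$1$2 * A$1$2 + A$2$2 * A$2$2 = 1" "A$1$1 * A$2$2 - A$1$2 * A$2$1 = 1"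
    by (simp_all add: matrix2_eq_iff matrix_matrix_mult_def transpose_def mat_def sum_2 det_2)
  then show "A$1$1^2 + A$2$1^2 = 1"
    by (simp add: power2_eq_square)
  \<comment> \<open>Multiplying an entry by the squared length 1 of the first column lets it be
    regrouped into the determinant and the inner product of the columns, whose values are
    known.\<close>
  have "A$2$2 = A$2$2 * (A$1$1 * A$1$1 + A$2$1 * A$2$1)" by (simp add: *)
  also have "\<dots> = A$1$1 * (A$1$1 * A$2$2 - A$1$2 * A$2$1) + A$2$1 * (A$1$1 * A$1$2 + A$2$1 * A$2$2)"
    by algebra
  finally show "A$2$2 = A$1$1" by (simp add: *)
  have "A$1$2 = A$1$2 * (A$1$1 * A$1$1 + A$2$1 * A$2$1)" by (simp add: *)
  also have "\<dots> = - A$2$1 * (A$1$1 * A$2$2 - A$1$2 * A$2$1) + A$1$1 * (A$1$1 * A$1$2 + A$2$1 * A$2$2)"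
    by algebra
  finally show "A$1$2 = - A$2$1" by (simp add: *)
qed

text \<open>The first column is a unit complex number. The angle is given explicitly as an
  \<open>Arg\<close>, not merely asserted to exist, because later the angles must tend to 0 when the
  matrices tend to the identity.\<close>

lemma rotation_matrix_2_Arg:
  assumes "rotation_matrix (A :: real^2^2)"
  shows "A = rotm (Arg (Complex (A$1$1) (A$2$1)))"
proof -
  note e = rotation_matrix_2_entries[OF assms]
  define z where "z = Complex (A$1$1) (A$2$1)"
  have "cmod z = 1"
    using e(3) by (simp add: cmod_def z_def)
  then have "z \<noteq> 0"
    by auto
  from cis_Arg[OF this] have "cis (Arg z) = z"
    by (simp add: sgn_eq \<open>cmod z = 1\<close>)
  then have "cos (Arg z) = Re z" "sin (Arg z) = Im z"
    using cis.simps[of "Arg z"] by simp_all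
  then show ?thesis
    unfolding z_def[symmetric] by (simp add: matrix2_eq_iff e z_def)
qed

lemma tendsto_rotm [tendsto_intros]:
  assumes "(f \<longlongrightarrow> l) F"
  shows "((\<lambda>x. rotm (f x)) \<longlongrightarrow> rotm l) F"
proof (intro vec_tendstoI)
  fix i j :: 2
  show "((\<lambda>x. rotm (f x) $ i $ j) \<longlongrightarrow> rotm l $ i $ j) F"
    using exhaust_2[of i] exhaust_2[of j] assms
    by (elim disjE) (auto intro!: tendsto_minus isCont_tendsto_compose[OF isCont_cos] isCont_tendsto_compose[OF isCont_sin])
qed

text \<open>The \<open>xy\<close>-plane is identified with \<open>\<complex>\<close>; these are the elements of the identity component.\<close>

definition motion :: "complex \<Rightarrow> real \<Rightarrow> real \<Rightarrow> real \<Rightarrow> sol_isometry" where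
  "motion w z t \<theta> = ((Re w, Im w, z, t), rotm \<theta>, 1)"

lemma motion_in_Isom: "motion w z t \<theta> \<in> carrier Isom"
  using rotation_matrix_rotm by (auto simp: motion_def Isom_def rotation_matrix_def)

text \<open>In the complex picture the dilation by exp t and the rotation by \<theta> merge into the
  single factor exp (t + i \<theta>), so the plane component has the same form as the
  z-component.\<close>

lemma isom_mult_motion:
  "isom_mult (motion w z t \<theta>) (motion w' z' t' \<theta>') =
     motion (w + exp (Complex t \<theta>) * w') (z + exp (-2 * t) * z') (t + t') (\<theta> + \<theta>')"
  by (simp add: motion_def rotm_mult matrix_vector_mult_def sum_2 Re_exp Im_exp algebra_simps)

lemma motion_0: "motion 0 0 0 0 = \<one>\<^bsub>Isom\<^esub>"
  by (simp add: motion_def Isom_def rotm_0)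

lemma isom_act_motion_0: "isom_act (motion w z t \<theta>) (0, 0, 0, 0) = (Re w, Im w, z, t)"
  by (simp add: motion_def matrix_vector_mult_def sum_2)

lemma tendsto_motion:
  assumes "(w \<longlongrightarrow> w') F" "(z \<longlongrightarrow> z') F" "(t \<longlongrightarrow> t') F" "(\<theta> \<longlongrightarrow> \<theta>') F"
  shows "((\<lambda>n. motion (w n) (z n) (t n) (\<theta> n)) \<longlongrightarrow> motion w' z' t' \<theta>') F"
  unfolding motion_def by (intro tendsto_intros assms)

text \<open>
  The exponential map of the Lie algebra \<open>\<complex> \<times> \<real> \<times> \<real> \<times> \<real>\<close> of the isometry group; the last
  component is the angular velocity of the rotation.
\<close>

definition expm :: "complex \<Rightarrow> real \<Rightarrow> real \<Rightarrow> real \<Rightarrow> sol_isometry" where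
  "expm w z d \<omega> = motion (w * exprel (Complex d \<omega>)) (z * exprel (-2 * d)) d \<omega>"

declare tendsto_Complex [tendsto_intros]

lemma tendsto_expm:
  assumes "(w \<longlongrightarrow> w') F" "(z \<longlongrightarrow> z') F" "(t \<longlongrightarrow> t') F" "(\<theta> \<longlongrightarrow> \<theta>') F"
  shows "((\<lambda>n. expm (w n) (z n) (t n) (\<theta> n)) \<longlongrightarrow> expm w' z' t' \<theta>') F"
  unfolding expm_def by (intro tendsto_motion tendsto_intros assms)

lemma exprel_uminus: "exp c * exprel (- c) = exprel c"
  by (simp add: exprel_def exp_minus field_simps)

lemma expm_inverse: "isom_mult (expm w z d \<omega>) (expm (- w) (- z) (- d) (- \<omega>)) = \<one>\<^bsub>Isom\<^esub>"
proof -
  have "Complex (-d) (-\<omega>) = - Complex d \<omega>"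
    by (simp add: complex_eq_iff)
  then show ?thesis
    using exprel_uminus[of "Complex d \<omega>"] exprel_uminus[of "-2*d"]
    by (simp add: expm_def isom_mult_motion mult.left_commute[of "exp _"] flip: motion_0)
qed


section \<open>The Lie algebra of a closed group of isometries\<close>

text \<open>Closedness is meant in the ambient product space, so that limits of sequences need no
  membership test. For subgroups it agrees with relative closedness by
  \<open>closed_carrier_Isom\<close>.\<close>

locale closed_isom_subgroup =
  fixes G :: "sol_isometry set"
  assumes subgr: "subgroup G Isom" and closed: "closed G"
begin

lemma mult_mem: "g \<in> G \<Longrightarrow> h \<in> G \<Longrightarrow> isom_mult g h \<in> G"
  using subgroup.m_closed[OF subgr] by (simp add: Isom_def)

lemma one_mem: "\<one>\<^bsub>Isom\<^esub> \<in> G"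
  using subgroup.one_closed[OF subgr] .

lemma inverse_mem:
  assumes "g \<in> G" "h \<in> carrier Isom" "isom_mult g h = \<one>\<^bsub>Isom\<^esub>"
  shows "h \<in> G"
proof -
  have g: "g \<in> carrier Isom"
    using subgroup.mem_carrier[OF subgr assms(1)] .
  have "g \<otimes>\<^bsub>Isom\<^esub> h = \<one>\<^bsub>Isom\<^esub>"
    using assms(3) by (simp add: Isom_def)
  then have "h \<otimes>\<^bsub>Isom\<^esub> g = \<one>\<^bsub>Isom\<^esub>"
    by (rule group.inv_comm[OF group_Isom]) (rule g, rule assms(2))
  then have "inv\<^bsub>Isom\<^esub> g = h"
    by (rule group.inv_equality[OF group_Isom]) (rule g, rule assms(2))
  then show ?thesis
    using subgroup.m_inv_closed[OF subgr assms(1)] by simp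
qed

text \<open>This is the k-th power of the motion written out: the translations add up to geometric
  sums in the two dilation factors.\<close>

lemma motion_power_mem:
  assumes "motion w z t \<theta> \<in> G"
  shows "motion (w * (\<Sum>j<k. exp (Complex t \<theta>) ^ j)) (z * (\<Sum>j<k. exp (-2 * t) ^ j)) (real k * t) (real k * \<theta>) \<in> G"
proof (induction k)
  case 0
  then show ?case using one_mem by (simp add: motion_0)
next
  case (Suc k)
  have 1: "exp (Complex (real k * t) (real k * \<theta>)) = exp (Complex t \<theta>) ^ k"
  proof -
    have "Complex (real k * t) (real k * \<theta>) = of_nat k * Complex t \<theta>"
      by (simp add: complex_eq_iff)
    then show ?thesis by (simp add: exp_of_nat_mult)
  qed
  have 2: "exp (-2 * (real k * t)) = exp (-2 * t) ^ k"
    by (simp flip: exp_of_nat_mult add: algebra_simps)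
  show ?case
    using mult_mem[OF Suc assms] unfolding isom_mult_motion 1 2
    by (simp add: algebra_simps)
qed

definition lie :: "complex \<Rightarrow> real \<Rightarrow> real \<Rightarrow> real \<Rightarrow> bool" where
  "lie w z d \<omega> \<longleftrightarrow> (\<forall>s. expm (of_real s * w) (s * z) (s * d) (s * \<omega>) \<in> G)"

text \<open>
  The closed subgroup argument: the powers of \<open>g n\<close> with exponents \<open>\<lfloor>s * m n\<rfloor>\<close> stay in \<open>G\<close> and
  converge to the value at time \<open>s\<close> of the one-parameter group.
\<close>

lemma lie_limit:
  assumes G: "\<And>n. motion (w' n) (z' n) (d' n) (l' n) \<in> G"
    and m: "filterlim m at_top sequentially"
    and w: "(\<lambda>n. of_real (m n) * w' n) \<longlonglongrightarrow> w" and z: "(\<lambda>n. m n * z' n) \<longlonglongrightarrow> z"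
    and d: "(\<lambda>n. m n * d' n) \<longlonglongrightarrow> d" and l: "(\<lambda>n. m n * l' n) \<longlonglongrightarrow> l"
  shows "lie w z d l"
proof -
  have inv0: "(\<lambda>n. inverse (m n)) \<longlonglongrightarrow> 0"
    using m by (rule tendsto_inverse_0_at_top)
  have mpos: "\<forall>\<^sub>F n in sequentially. m n > 0"
    using m by (simp add: filterlim_at_top_dense)
  have to0: "f \<longlonglongrightarrow> 0" if "(\<lambda>n. m n * f n) \<longlonglongrightarrow> a" for f a
  proof -
    have "(\<lambda>n. inverse (m n) * (m n * f n)) \<longlonglongrightarrow> 0 * a"
      by (intro tendsto_mult inv0 that)
    then have "(\<lambda>n. inverse (m n) * (m n * f n)) \<longlonglongrightarrow> 0" by simp
    then show ?thesis
      by (rule Lim_transform_eventually) (use mpos in eventually_elim, auto)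
  qed
  have pos: "expm (of_real s * w) (s * z) (s * d) (s * l) \<in> G" if s: "s \<ge> 0" for s
  proof -
    define k where "k n = nat \<lfloor>s * m n\<rfloor>" for n
    have k: "(\<lambda>n. real (k n) / m n) \<longlonglongrightarrow> s"
    proof (rule tendsto_sandwich)
      show "\<forall>\<^sub>F n in sequentially. s - inverse (m n) \<le> real (k n) / m n"
        using mpos
      proof eventually_elim
        case (elim n)
        have "s * m n - 1 \<le> real (k n)" unfolding k_def by linarith
        then have "(s * m n - 1) / m n \<le> real (k n) / m n"
          using elim by (intro divide_right_mono) auto
        then show ?case using elim by (simp add: diff_divide_distrib inverse_eq_divide)
      qed
      show "\<forall>\<^sub>F n in sequentially. real (k n) / m n \<le> s"
        using mpos
      proof eventually_elim
        case (elim n)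
        have "real (k n) \<le> s * m n" unfolding k_def using s elim by simp
        then show ?case using elim by (simp add: field_simps)
      qed
      show "(\<lambda>n. s - inverse (m n)) \<longlonglongrightarrow> s"
        using tendsto_diff[OF tendsto_const inv0] by simp
    qed simp
    have kreal: "(\<lambda>n. real (k n) * f n) \<longlonglongrightarrow> s * a" if "(\<lambda>n. m n * f n) \<longlonglongrightarrow> a" for f a
    proof -
      have "(\<lambda>n. real (k n) / m n * (m n * f n)) \<longlonglongrightarrow> s * a"
        by (intro tendsto_mult k that)
      then show ?thesis
        by (rule Lim_transform_eventually) (use mpos in eventually_elim, auto)
    qed
    have kw: "(\<lambda>n. of_nat (k n) * w' n) \<longlonglongrightarrow> of_real s * w"
    proof -
      have "(\<lambda>n. of_real (real (k n) / m n) * (of_real (m n) * w' n)) \<longlonglongrightarrow> of_real s * w"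
        by (intro tendsto_mult tendsto_of_real k w)
      then show ?thesis
        by (rule Lim_transform_eventually) (use mpos in eventually_elim, auto)
    qed
    note c0 = tendsto_Complex[OF to0[OF d] to0[OF l]]
    have C: "of_nat (k n) * Complex (d' n) (l' n) = Complex (real (k n) * d' n) (real (k n) * l' n)" for n
      by (simp add: complex_eq_iff)
    have "(\<lambda>n. w' n * (\<Sum>j<k n. exp (Complex (d' n) (l' n)) ^ j)) \<longlonglongrightarrow>
            of_real s * w * exprel (Complex (s * d) (s * l))"
      using c0 unfolding zero_complex.code[symmetric]
      by (intro tendsto_geometric_exprel kw)
        (auto simp: C intro!: tendsto_Complex kreal d l)
    moreover have "(\<lambda>n. z' n * (\<Sum>j<k n. exp (-2 * d' n) ^ j)) \<longlonglongrightarrow> s * z * exprel (-2 * (s * d))"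
    proof (rule tendsto_geometric_exprel)
      show "(\<lambda>n. real (k n) * z' n) \<longlonglongrightarrow> s * z"
        using kreal[OF z] by simp
      show "(\<lambda>n. real (k n) * (-2 * d' n)) \<longlonglongrightarrow> -2 * (s * d)"
        using tendsto_mult[OF tendsto_const kreal[OF d], of "-2"] by (simp add: algebra_simps)
      show "(\<lambda>n. -2 * d' n) \<longlonglongrightarrow> 0"
        using tendsto_mult[OF tendsto_const to0[OF d], of "-2"] by simp
    qed
    ultimately have "(\<lambda>n. motion (w' n * (\<Sum>j<k n. exp (Complex (d' n) (l' n)) ^ j))
          (z' n * (\<Sum>j<k n. exp (-2 * d' n) ^ j)) (real (k n) * d' n) (real (k n) * l' n))
         \<longlonglongrightarrow> expm (of_real s * w) (s * z) (s * d) (s * l)"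
      unfolding expm_def by (intro tendsto_motion kreal d l)
    then show ?thesis
      by (rule closed_sequentially[OF closed motion_power_mem[OF G]])
  qed
  show ?thesis
    unfolding lie_def
  proof
    fix s
    show "expm (of_real s * w) (s * z) (s * d) (s * l) \<in> G"
    proof (cases "s \<ge> 0")
      case False
      \<comment> \<open>A negative time is reached by inverting the value at the positive time
        \<open>-s\<close>.\<close>
      then have "expm (of_real (-s) * w) (-s * z) (-s * d) (-s * l) \<in> G"
        by (intro pos) auto
      moreover have "expm (of_real s * w) (s * z) (s * d) (s * l) \<in> carrier Isom"
        unfolding expm_def by (rule motion_in_Isom)
      ultimately show ?thesis
        by (rule inverse_mem)
          (use expm_inverse[of "of_real (-s) * w" "-s*z" "-s*d" "-s*l"] in simp)
    next
      case True
      then show ?thesis by (rule pos)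
    qed
  qed
qed

section \<open>Linear structure, adjoint action and bracket on the Lie algebra\<close>

lemma right_cancel_mem:
  assumes "isom_mult g h \<in> G" "h \<in> G" "g \<in> carrier Isom"
  shows "g \<in> G"
proof -
  interpret Isom: group Isom by (rule group_Isom)
  have h: "h \<in> carrier Isom"
    using subgroup.mem_carrier[OF subgr assms(2)] .
  have "g \<otimes>\<^bsub>Isom\<^esub> h \<in> G"
    using assms(1) by (simp add: Isom_def)
  from subgroup.m_closed[OF subgr this subgroup.m_inv_closed[OF subgr assms(2)]]
  show ?thesis
    using h assms(3) by (simp add: Isom.m_assoc)
qed

lemma expm_mem: "lie w z d l \<Longrightarrow> expm w z d l \<in> G"
  unfolding lie_def by (drule spec[of _ 1]) simp

lemma lie_scale: "lie w z d l \<Longrightarrow> lie (of_real c * w) (c * z) (c * d) (c * l)"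
  unfolding lie_def
proof
  fix s
  assume "\<forall>s. expm (of_real s * w) (s * z) (s * d) (s * l) \<in> G"
  from this[THEN spec, of "s * c"]
  show "expm (of_real s * (of_real c * w)) (s * (c * z)) (s * (c * d)) (s * (c * l)) \<in> G"
    by (simp add: mult.assoc)
qed

lemma lie_closed:
  assumes "\<And>n. lie (w n) (z n) (d n) (l n)"
    and "w \<longlonglongrightarrow> w'" "z \<longlonglongrightarrow> z'" "d \<longlonglongrightarrow> d'" "l \<longlonglongrightarrow> l'"
  shows "lie w' z' d' l'"
  unfolding lie_def
proof
  fix s
  have lim: "(\<lambda>n. expm (of_real s * w n) (s * z n) (s * d n) (s * l n)) \<longlonglongrightarrow>
          expm (of_real s * w') (s * z') (s * d') (s * l')"
    by (intro tendsto_expm tendsto_intros assms)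
  show "expm (of_real s * w') (s * z') (s * d') (s * l') \<in> G"
    by (rule closed_sequentially[OF closed _ lim]) (rule assms(1)[unfolded lie_def, THEN spec])
qed

lemma inverse_Suc_tendsto_0: "(\<lambda>n. inverse (real (Suc n)) * a) \<longlonglongrightarrow> 0"
  using tendsto_mult[OF LIMSEQ_inverse_real_of_nat tendsto_const, of a] by simp

lemma Complex_Suc_tendsto_0:
  "(\<lambda>n. Complex (inverse (real (Suc n)) * a) (inverse (real (Suc n)) * b)) \<longlonglongrightarrow> 0"
  using tendsto_Complex[OF inverse_Suc_tendsto_0 inverse_Suc_tendsto_0]
  unfolding zero_complex.code[symmetric] .

lemma filterlim_real_Suc: "filterlim (\<lambda>n. real (Suc n)) at_top sequentially"
  by (rule filterlim_compose[OF filterlim_real_sequentially filterlim_Suc])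

text \<open>To first order a product of two small motions adds their velocities. The products of the
  two one-parameter groups at time 1/(n+1), magnified by n+1, tend to the sum, and
  \<open>lie_limit\<close> makes this limit a vector of the Lie algebra.\<close>

lemma lie_add:
  assumes "lie w z d l" "lie w' z' d' l'"
  shows "lie (w + w') (z + z') (d + d') (l + l')"
proof -
  define s where "s n = inverse (real (Suc n))" for n
  have Ns: "real (Suc n) * s n = 1" "of_real (real (Suc n)) * of_real (s n) = (1 :: complex)" for n
  proof -
    show "real (Suc n) * s n = 1"
      by (simp add: s_def del: of_nat_Suc)
    then show "of_real (real (Suc n)) * of_real (s n) = (1 :: complex)"
      by (simp only: of_real_mult[symmetric] of_real_1)
  qed
  \<comment> \<open>Both displacements contain the time step \<open>s\<close>. The magnification
    \<open>N\<close> cancels it exactly, and the factors \<open>e\<close>, \<open>e'\<close>,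
    \<open>x\<close> that remain tend to 1.\<close>
  have cancel: "N * (s * w * e + x * (s * w' * e')) = w * e + x * (w' * e')"
    if "N * s = 1" for N s w e x w' e' :: "'x :: comm_ring_1"
  proof -
    have "N * (s * w * e + x * (s * w' * e')) = (N * s) * (w * e + x * (w' * e'))"
      by (simp add: algebra_simps)
    then show ?thesis using that by simp
  qed
  define e1 where "e1 n = exprel (Complex (s n * d) (s n * l))" for n
  define e2 where "e2 n = exprel (Complex (s n * d') (s n * l'))" for n
  define f1 where "f1 n = exprel (-2 * (s n * d))" for n
  define f2 where "f2 n = exprel (-2 * (s n * d'))" for n
  have c: "(\<lambda>n. Complex (s n * a) (s n * b)) \<longlonglongrightarrow> 0" for a b
    unfolding s_def by (rule Complex_Suc_tendsto_0)
  have r: "(\<lambda>n. s n * a) \<longlonglongrightarrow> 0" for a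
    unfolding s_def by (rule inverse_Suc_tendsto_0)
  have r2: "(\<lambda>n. - 2 * (s n * a)) \<longlonglongrightarrow> 0" for a
    using tendsto_mult[OF tendsto_const r, of "-2"] by simp
  have e: "e1 \<longlonglongrightarrow> 1" "e2 \<longlonglongrightarrow> 1" "f1 \<longlonglongrightarrow> 1" "f2 \<longlonglongrightarrow> 1"
    using tendsto_exprel[OF c] tendsto_exprel[OF r2] unfolding e1_def e2_def f1_def f2_def by auto
  have G: "isom_mult (expm (of_real (s n) * w) (s n * z) (s n * d) (s n * l))
            (expm (of_real (s n) * w') (s n * z') (s n * d') (s n * l')) \<in> G" for n
    using assms mult_mem unfolding lie_def by blast
  show ?thesis
  proof (rule lie_limit[OF G[unfolded expm_def isom_mult_motion] filterlim_real_Suc])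
    have "(\<lambda>n. w * e1 n + exp (Complex (s n * d) (s n * l)) * (w' * e2 n)) \<longlonglongrightarrow> w * 1 + exp 0 * (w' * 1)"
      by (intro tendsto_intros c e)
    then show "(\<lambda>n. of_real (real (Suc n)) * (of_real (s n) * w * exprel (Complex (s n * d) (s n * l)) +
          exp (Complex (s n * d) (s n * l)) * (of_real (s n) * w' * exprel (Complex (s n * d') (s n * l')))))
        \<longlonglongrightarrow> w + w'"
      unfolding e1_def[symmetric] e2_def[symmetric] cancel[OF Ns(2)] by simp
    have "(\<lambda>n. z * f1 n + exp (-2 * (s n * d)) * (z' * f2 n)) \<longlonglongrightarrow> z * 1 + exp 0 * (z' * 1)"
      by (intro tendsto_intros r2 e)
    then show "(\<lambda>n. real (Suc n) * (s n * z * exprel (-2 * (s n * d)) +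
          exp (-2 * (s n * d)) * (s n * z' * exprel (-2 * (s n * d'))))) \<longlonglongrightarrow> z + z'"
      unfolding f1_def[symmetric] f2_def[symmetric] cancel[OF Ns(1)] by simp
    show "(\<lambda>n. real (Suc n) * (s n * d + s n * d')) \<longlonglongrightarrow> d + d'"
      "(\<lambda>n. real (Suc n) * (s n * l + s n * l')) \<longlonglongrightarrow> l + l'"
      using cancel[OF Ns(1), of _ _ 1 1 _ 1] by (simp_all del: of_nat_Suc)
  qed
qed

text \<open>Conjugation by h maps a one-parameter group to that of the adjoint image. It is used in
  the form h exp (s X) = exp (s Ad X) h and h is then cancelled on the right, so that no formula for
  its inverse enters.\<close>

lemma lie_Ad:
  assumes h: "motion w1 z1 t1 a1 \<in> G" and "lie w z d l"
  shows "lie (exp (Complex t1 a1) * w - Complex d l * w1) (exp (-2 * t1) * z + 2 * d * z1) d l"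
  unfolding lie_def
proof
  fix s
  let ?c = "Complex (s * d) (s * l)"
  let ?g = "expm (of_real s * (exp (Complex t1 a1) * w - Complex d l * w1))
              (s * (exp (-2 * t1) * z + 2 * d * z1)) (s * d) (s * l)"
  have "isom_mult (motion w1 z1 t1 a1) (expm (of_real s * w) (s * z) (s * d) (s * l)) \<in> G"
    using assms mult_mem unfolding lie_def by blast
  moreover have "isom_mult (motion w1 z1 t1 a1) (expm (of_real s * w) (s * z) (s * d) (s * l)) =
      isom_mult ?g (motion w1 z1 t1 a1)"
  proof -
    have c: "of_real s * Complex d l = ?c"
      by (simp add: complex_eq_iff)
    have "of_real s * (exp (Complex t1 a1) * w - Complex d l * w1) * exprel ?c + exp ?c * w1 =
        exp (Complex t1 a1) * (of_real s * w * exprel ?c) - w1 * (?c * exprel ?c) + exp ?c * w1"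
      unfolding c[symmetric] by (simp add: algebra_simps)
    also have "\<dots> = w1 + exp (Complex t1 a1) * (of_real s * w * exprel ?c)"
      unfolding mult_exprel by (simp add: algebra_simps)
    finally have w: "w1 + exp (Complex t1 a1) * (of_real s * w * exprel ?c) =
        of_real s * (exp (Complex t1 a1) * w - Complex d l * w1) * exprel ?c + exp ?c * w1" ..
    have "s * (exp (-2 * t1) * z + 2 * d * z1) * exprel (-2 * (s * d)) + exp (-2 * (s * d)) * z1 =
        exp (-2 * t1) * (s * z * exprel (-2 * (s * d))) - z1 * (-2 * (s * d) * exprel (-2 * (s * d))) + exp (-2 * (s * d)) * z1"
      by (simp add: algebra_simps)
    also have "\<dots> = z1 + exp (-2 * t1) * (s * z * exprel (-2 * (s * d)))"
      unfolding mult_exprel by (simp add: algebra_simps)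
    finally show ?thesis
      unfolding expm_def isom_mult_motion w by (simp add: add.commute)
  qed
  ultimately have "isom_mult ?g (motion w1 z1 t1 a1) \<in> G"
    by simp
  then show "?g \<in> G"
    by (rule right_cancel_mem[OF _ h]) (simp add: expm_def motion_in_Isom)
qed

text \<open>Differentiates \<open>lie_Ad\<close> along the one-parameter group of the first vector at time \<open>0\<close>.\<close>

lemma lie_bracket:
  assumes 1: "lie w1 z1 d1 l1" and 2: "lie w z d l"
  shows "lie (Complex d1 l1 * w - Complex d l * w1) (2 * d * z1 - 2 * d1 * z) 0 0"
proof -
  define s where "s n = inverse (real (Suc n))" for n
  have [simp]: "s n \<noteq> 0" for n
    unfolding s_def by simp
  \<comment> \<open>Algebra of the difference quotient: \<open>i\<close> stands for 1/s and
    \<open>x\<close> for exp (s c), expanded exactly as 1 + s c e with e = exprel (s c).\<close>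
  have cancel: "i * (x * w - k * (s * w1 * e) - w) = e * (c * w - k * w1)"
    if "i * s = 1" "x = 1 + s * c * e" for i s x c e w k w1 :: "'x :: comm_ring_1"
  proof -
    have "i * (x * w - k * (s * w1 * e) - w) = (i * s) * (e * (c * w - k * w1))"
      by (simp add: that(2) algebra_simps)
    then show ?thesis using that(1) by simp
  qed
  let ?c = "\<lambda>n. Complex (s n * d1) (s n * l1)" and ?r = "\<lambda>n. -2 * (s n * d1)"
  have l: "lie (exprel (?c n) * (Complex d1 l1 * w - Complex d l * w1))
        (exprel (?r n) * (2 * d * z1 - 2 * d1 * z)) 0 0" for n
  proof -
    have "motion (of_real (s n) * w1 * exprel (?c n)) (s n * z1 * exprel (?r n)) (s n * d1) (s n * l1) \<in> G"
      using 1 unfolding lie_def expm_def by blast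
    \<comment> \<open>The adjoint action preserves the last two components, so subtracting the
      vector itself makes them 0.\<close>
    from lie_scale[OF lie_add[OF lie_Ad[OF this 2] lie_scale[OF 2, of "-1"]], of "inverse (s n)"]
    have "lie (of_real (inverse (s n)) * (exp (?c n) * w - Complex d l * (of_real (s n) * w1 * exprel (?c n)) + of_real (- 1) * w))
       (inverse (s n) * (exp (?r n) * z + 2 * d * (s n * z1 * exprel (?r n)) + - 1 * z)) 0 0"
      by simp
    moreover have "of_real (inverse (s n)) * (exp (?c n) * w - Complex d l * (of_real (s n) * w1 * exprel (?c n)) + of_real (- 1) * w)
        = exprel (?c n) * (Complex d1 l1 * w - Complex d l * w1)"
    proof -
      have "of_real (s n) * Complex d1 l1 = ?c n"
        by (simp add: complex_eq_iff)
      with mult_exprel[of "?c n"] have e: "exp (?c n) = 1 + of_real (s n) * Complex d1 l1 * exprel (?c n)"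
        by simp
      have "of_real (inverse (s n)) * of_real (s n) = (1 :: complex)"
        by (simp flip: of_real_mult)
      from cancel[OF this e, of w "Complex d l" w1] show ?thesis
        by (simp add: algebra_simps)
    qed
    moreover have "inverse (s n) * (exp (?r n) * z + 2 * d * (s n * z1 * exprel (?r n)) + - 1 * z) =
        exprel (?r n) * (2 * d * z1 - 2 * d1 * z)"
      using cancel[of "inverse (s n)" "s n" "exp (?r n)" "-2 * d1" "exprel (?r n)" z "-2 * d" z1]
        mult_exprel[of "?r n"] by (simp add: algebra_simps)
    ultimately show ?thesis by simp
  qed
  have c: "?c \<longlonglongrightarrow> 0"
    unfolding s_def by (rule Complex_Suc_tendsto_0)
  have r: "?r \<longlonglongrightarrow> 0"
    using tendsto_mult[OF tendsto_const inverse_Suc_tendsto_0, of "-2" d1] unfolding s_def by simp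
  show ?thesis
  proof (rule lie_closed[OF l])
    show "(\<lambda>n. exprel (?c n) * (Complex d1 l1 * w - Complex d l * w1)) \<longlonglongrightarrow> Complex d1 l1 * w - Complex d l * w1"
      using tendsto_mult[OF tendsto_exprel[OF c] tendsto_const] by simp
    show "(\<lambda>n. exprel (?r n) * (2 * d * z1 - 2 * d1 * z)) \<longlonglongrightarrow> 2 * d * z1 - 2 * d1 * z"
      using tendsto_mult[OF tendsto_exprel[OF r] tendsto_const] by simp
  qed simp_all
qed

text \<open>
  If the rotation angles decay more slowly than \<open>1 / m n\<close>, rescaling by them instead shows that \<open>G\<close>
  contains all rotations about the origin, and then the angles can be removed.
\<close>

lemma lie_limit_rotation:
  assumes G: "\<And>n. motion (w' n) (z' n) (d' n) (\<theta> n) \<in> G"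
    and m: "filterlim m at_top sequentially"
    and w: "(\<lambda>n. of_real (m n) * w' n) \<longlonglongrightarrow> w" and z: "(\<lambda>n. m n * z' n) \<longlonglongrightarrow> z"
    and d: "(\<lambda>n. m n * d' n) \<longlonglongrightarrow> d" and \<theta>: "\<theta> \<longlonglongrightarrow> 0"
  shows "\<exists>l. lie w z d l"
proof (cases "lie 0 0 0 1")
  case True
  have "motion (w' n) (z' n) (d' n) 0 \<in> G" for n
  proof -
    have "motion 0 0 0 (- \<theta> n) \<in> G"
      using True[unfolded lie_def expm_def] by (auto dest!: spec[of _ "- \<theta> n"])
    from mult_mem[OF G[of n] this] show ?thesis
      by (simp add: isom_mult_motion)
  qed
  from lie_limit[OF this m w z d, of 0] show ?thesis
    by auto
next
  case False
  \<comment> \<open>The pair (1, m \<theta>) is normalised so that its absolute values add up to 1,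
    which yields a convergent subsequence. If \<open>a0\<close> is nonzero then m \<theta> converges
    to b0 / a0; if it is 0 then m \<theta> is unbounded and \<open>b0\<close> is 1 or -1.\<close>
  define a where "a n = 1 / (1 + \<bar>m n * \<theta> n\<bar>)" for n
  define b where "b n = m n * \<theta> n / (1 + \<bar>m n * \<theta> n\<bar>)" for n
  have pos: "1 + \<bar>x\<bar> > 0" for x :: real
    by linarith
  have apos: "a n > 0" for n
    unfolding a_def using pos by simp
  have ab: "\<bar>b n\<bar> = 1 - a n" "b n = a n * (m n * \<theta> n)" for n
    unfolding a_def b_def using pos[of "m n * \<theta> n"] by (simp_all add: field_simps abs_mult)
  have "norm (a n, b n) \<le> 2" for n
    using norm_Pair_le[of "a n" "b n"] ab(1)[of n] apos[of n] by simp
  then have "bounded (range (\<lambda>n. (a n, b n)))"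
    by (auto simp: bounded_iff)
  then obtain r ab where r: "strict_mono r" and lim: "((\<lambda>n. (a n, b n)) \<circ> r) \<longlonglongrightarrow> ab"
    using bounded_imp_convergent_subsequence by blast
  obtain a0 b0 where "ab = (a0, b0)" by (cases ab)
  with lim have a0: "(\<lambda>n. a (r n)) \<longlonglongrightarrow> a0" and b0: "(\<lambda>n. b (r n)) \<longlonglongrightarrow> b0"
    using tendsto_fst[OF lim] tendsto_snd[OF lim] by (simp_all add: o_def)
  have m': "filterlim (\<lambda>n. m (r n)) at_top sequentially"
    by (rule filterlim_compose[OF m filterlim_subseq[OF r]])
  have sub: "(\<lambda>n. of_real (m (r n)) * w' (r n)) \<longlonglongrightarrow> w" "(\<lambda>n. m (r n) * z' (r n)) \<longlonglongrightarrow> z"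
      "(\<lambda>n. m (r n) * d' (r n)) \<longlonglongrightarrow> d" "(\<lambda>n. \<theta> (r n)) \<longlonglongrightarrow> 0"
    using LIMSEQ_subseq_LIMSEQ[OF w r] LIMSEQ_subseq_LIMSEQ[OF z r]
      LIMSEQ_subseq_LIMSEQ[OF d r] LIMSEQ_subseq_LIMSEQ[OF \<theta> r] by (simp_all add: o_def)
  have b0a0: "\<bar>b0\<bar> = 1 - a0"
  proof (rule LIMSEQ_unique)
    show "(\<lambda>n. \<bar>b (r n)\<bar>) \<longlonglongrightarrow> \<bar>b0\<bar>"
      by (intro tendsto_intros b0)
    show "(\<lambda>n. \<bar>b (r n)\<bar>) \<longlonglongrightarrow> 1 - a0"
      unfolding ab(1) by (intro tendsto_intros a0)
  qed
  show ?thesis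
  proof (cases "a0 = 0")
    case False
    have "(\<lambda>n. b (r n) / a (r n)) \<longlonglongrightarrow> b0 / a0"
      by (intro tendsto_intros a0 b0 False)
    moreover have "b (r n) / a (r n) = m (r n) * \<theta> (r n)" for n
      using apos[of "r n"] by (simp add: ab(2))
    ultimately have "(\<lambda>n. m (r n) * \<theta> (r n)) \<longlonglongrightarrow> b0 / a0" by simp
    from lie_limit[OF G m' sub(1-3) this] show ?thesis by blast
  next
    case True
    \<comment> \<open>At the coarser scale \<mu> = m / (1 + |m \<theta>|) the angles converge to
      \<open>b0\<close> and all other components to 0. The scale still tends to infinity, since
      \<mu> \<theta> has a nonzero limit while \<theta> tends to 0.\<close>
    define \<mu> where "\<mu> n = a (r n) * m (r n)" for n
    have \<mu>\<theta>: "(\<lambda>n. \<mu> n * \<theta> (r n)) \<longlonglongrightarrow> b0"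
      using b0 by (simp add: ab(2) \<mu>_def mult.assoc)
    have bne: "b0 \<noteq> 0"
      using b0a0 True by auto
    have "(\<lambda>n. \<theta> (r n) / (\<mu> n * \<theta> (r n))) \<longlonglongrightarrow> 0 / b0"
      by (intro tendsto_intros sub(4) \<mu>\<theta> bne)
    moreover have "\<forall>\<^sub>F n in sequentially. \<theta> (r n) / (\<mu> n * \<theta> (r n)) = inverse (\<mu> n)"
      using tendsto_imp_eventually_ne[OF \<mu>\<theta> bne] by eventually_elim (simp add: field_simps)
    ultimately have "(\<lambda>n. inverse (\<mu> n)) \<longlonglongrightarrow> 0"
      using Lim_transform_eventually by fastforce
    moreover have mpos: "\<forall>\<^sub>F n in sequentially. \<mu> n > 0"
    proof -
      have "\<forall>\<^sub>F n in sequentially. m (r n) > 0"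
        using m' by (simp add: filterlim_at_top_dense)
      then show ?thesis
        by eventually_elim (use apos in \<open>simp add: \<mu>_def\<close>)
    qed
    ultimately have "filterlim (\<lambda>n. inverse (inverse (\<mu> n))) at_top sequentially"
      by (intro filterlim_inverse_at_top) (auto elim: eventually_mono)
    then have \<mu>: "filterlim \<mu> at_top sequentially"
      by simp
    have "(\<lambda>n. of_real (a (r n)) * (of_real (m (r n)) * w' (r n))) \<longlonglongrightarrow> of_real a0 * w"
      "(\<lambda>n. a (r n) * (m (r n) * z' (r n))) \<longlonglongrightarrow> a0 * z" "(\<lambda>n. a (r n) * (m (r n) * d' (r n))) \<longlonglongrightarrow> a0 * d"
      by (intro tendsto_intros a0 sub)+
    then have "lie 0 0 0 b0"
      by (intro lie_limit[OF G \<mu> _ _ _ \<mu>\<theta>]) (simp_all add: True \<mu>_def mult.assoc)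
    \<comment> \<open>\<open>b0\<close> is 1 or -1, so scaling by \<open>b0\<close> itself produces
      b0 * b0 = 1.\<close>
    from lie_scale[OF this, of "b0"] have "lie 0 0 0 1"
      using b0a0 True by (auto simp: abs_if split: if_splits)
    with False show ?thesis by simp
  qed
qed

end


section \<open>Tangent vectors of orbits and the subalgebras they generate\<close>

lemma orthogonal_matrix_2_iff:
  "orthogonal_matrix (A :: real^2^2) \<longleftrightarrow>
     A$1$1 * A$1$1 + A$2$1 * A$2$1 = 1 \<and> A$1$1 * A$1$2 + A$2$1 * A$2$2 = 0 \<and>
     A$1$2 * A$1$2 + A$2$2 * A$2$2 = 1"
  by (auto simp: orthogonal_matrix matrix2_eq_iff matrix_matrix_mult_def transpose_def mat_def sum_2 mult.commute)

lemma compact_orthogonal_matrices_2: "compact {A :: real^2^2. orthogonal_matrix A}"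
proof -
  have "closed {A :: real^2^2. orthogonal_matrix A}"
    unfolding orthogonal_matrix_2_iff
    by (intro closed_Collect_conj closed_Collect_eq continuous_intros)
  moreover have "norm A \<le> 4" if "orthogonal_matrix A" for A :: "real^2^2"
  proof -
    have *: "A$1$1^2 + A$2$1^2 = 1" "A$1$2^2 + A$2$2^2 = 1"
      using that by (simp_all add: orthogonal_matrix_2_iff power2_eq_square)
    then have "A$1$1^2 \<le> 1" "A$2$1^2 \<le> 1" "A$1$2^2 \<le> 1" "A$2$2^2 \<le> 1"
      using zero_le_power2[of "A$1$1"] zero_le_power2[of "A$2$1"]
        zero_le_power2[of "A$1$2"] zero_le_power2[of "A$2$2"] by linarith+
    then have 1: "\<bar>A$i$j\<bar> \<le> 1" for i j
      using exhaust_2[of i] exhaust_2[of j] by (auto simp: abs_square_le_1)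
    have "norm (A$i) \<le> 2" for i
    proof -
      have "norm (A$i) \<le> \<bar>A$i$1\<bar> + \<bar>A$i$2\<bar>"
        using norm_le_l1_cart[of "A$i"] by (simp add: sum_2)
      with 1[of i 1] 1[of i 2] show ?thesis by linarith
    qed
    from this[of 1] this[of 2] have "norm (A$1) + norm (A$2) \<le> 4"
      by linarith
    moreover have "norm A \<le> norm (A$1) + norm (A$2)"
      using L2_set_le_sum[of UNIV "\<lambda>i. norm (A$i)"] by (simp add: norm_vec_def sum_2)
    ultimately show ?thesis
      by linarith
  qed
  then have "bounded {A :: real^2^2. orthogonal_matrix A}"
    by (auto simp: bounded_iff)
  ultimately show ?thesis
    by (simp add: compact_eq_bounded_closed)
qed

lemma tendsto_matrix_mult_2 [tendsto_intros]:
  fixes B :: "real^2^2"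
  assumes "(f \<longlongrightarrow> A) F"
  shows "((\<lambda>x. f x ** B) \<longlongrightarrow> A ** B) F"
  unfolding matrix_matrix_mult_def
  by (intro vec_tendstoI) (simp, intro tendsto_intros assms tendsto_vec_nth)

text \<open>Orthogonal matrices have determinant 1 or -1, and by continuity the determinant becomes
  positive near the identity.\<close>

lemma det_orthogonal_eventually_1:
  fixes B :: "'b \<Rightarrow> real^2^2"
  assumes "(B \<longlongrightarrow> mat 1) F" "\<And>n. orthogonal_matrix (B n)"
  shows "\<forall>\<^sub>F n in F. rotation_matrix (B n)"
proof -
  have "((\<lambda>n. det (B n)) \<longlongrightarrow> det (mat 1 :: real^2^2)) F"
    unfolding det_2 by (intro tendsto_intros tendsto_vec_nth assms)
  then have "((\<lambda>n. det (B n)) \<longlongrightarrow> 1) F"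
    by simp
  then have "\<forall>\<^sub>F n in F. det (B n) > 0"
    by (rule order_tendstoD) simp
  then show ?thesis
    by eventually_elim (use assms(2) det_orthogonal_matrix in \<open>fastforce simp: rotation_matrix_def\<close>)
qed

context closed_isom_subgroup
begin

text \<open>
  The isotropy group is compact, so after passing to a subsequence and multiplying by the inverse of
  an isotropy element the isometries carrying the origin to nearby orbit points tend to the identity.
\<close>

lemma lie_tangent:
  assumes G: "\<And>n. ((Re (w' n), Im (w' n), z' n, d' n), A n, e n) \<in> G"
    and m: "filterlim m at_top sequentially"
    and w: "(\<lambda>n. of_real (m n) * w' n) \<longlonglongrightarrow> w" and z: "(\<lambda>n. m n * z' n) \<longlonglongrightarrow> z"
    and d: "(\<lambda>n. m n * d' n) \<longlonglongrightarrow> d"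
    and w0: "w' \<longlonglongrightarrow> 0" and z0: "z' \<longlonglongrightarrow> 0" and d0: "d' \<longlonglongrightarrow> 0"
  shows "\<exists>l. lie w z d l"
proof -
  let ?K = "{A :: real^2^2. orthogonal_matrix A} \<times> {1, -1 :: real}"
  have carr: "orthogonal_matrix (A n)" "e n = 1 \<or> e n = -1" for n
    using subgroup.mem_carrier[OF subgr G[of n]] by (auto simp: Isom_def)
  have "compact ?K"
    by (intro compact_Times compact_orthogonal_matrices_2 finite_imp_compact) simp
  moreover have "(A n, e n) \<in> ?K" for n
    using carr by auto
  ultimately obtain Ae r where Ae: "Ae \<in> ?K" and r: "strict_mono r"
      and lim: "((\<lambda>n. (A n, e n)) \<circ> r) \<longlonglongrightarrow> Ae"
    using seq_compactE[of ?K "\<lambda>n. (A n, e n)"] unfolding compact_eq_seq_compact_metric by blast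
  obtain A0 e0 where A0e0: "Ae = (A0, e0)" by (cases Ae)
  have A0: "orthogonal_matrix A0" and e0: "e0 = 1 \<or> e0 = -1"
    using Ae by (auto simp: A0e0)
  have Alim: "(\<lambda>n. A (r n)) \<longlonglongrightarrow> A0" and elim: "(\<lambda>n. e (r n)) \<longlonglongrightarrow> e0"
    using tendsto_fst[OF lim] tendsto_snd[OF lim] by (simp_all add: o_def A0e0)
  have sub0: "(\<lambda>n. w' (r n)) \<longlonglongrightarrow> 0" "(\<lambda>n. z' (r n)) \<longlonglongrightarrow> 0" "(\<lambda>n. d' (r n)) \<longlonglongrightarrow> 0"
    using LIMSEQ_subseq_LIMSEQ[OF w0 r] LIMSEQ_subseq_LIMSEQ[OF z0 r] LIMSEQ_subseq_LIMSEQ[OF d0 r]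
    by (simp_all add: o_def)
  have "(\<lambda>n. ((Re (w' (r n)), Im (w' (r n)), z' (r n), d' (r n)), A (r n), e (r n))) \<longlonglongrightarrow>
      ((Re 0, Im 0, 0, 0), A0, e0)"
    by (intro tendsto_intros sub0 Alim elim)
  then have "((Re 0, Im 0, 0, 0), A0, e0) \<in> G"
    by (rule closed_sequentially[OF closed G])
  then have "((0, 0, 0, 0), A0, e0) \<in> G"
    by simp
  then have inv: "((0, 0, 0, 0), transpose A0, e0) \<in> G"
  proof (rule inverse_mem)
    show "isom_mult ((0, 0, 0, 0), A0, e0) ((0, 0, 0, 0), transpose A0, e0) = \<one>\<^bsub>Isom\<^esub>"
      using A0 e0 by (auto simp: Isom_def orthogonal_matrix_def matrix_vector_mult_def sum_2)
  qed (use A0 e0 in \<open>auto simp: Isom_def\<close>)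
  \<comment> \<open>Multiplication on the right by the inverse isotropy element fixes the origin
    first, so the translation parts stay as they are while the linear parts now tend to the
    identity.\<close>
  define B where "B n = A (r n) ** transpose A0" for n
  define \<theta> where "\<theta> n = Arg (Complex (B n $ 1 $ 1) (B n $ 2 $ 1))" for n
  have B: "B \<longlonglongrightarrow> mat 1"
    using tendsto_matrix_mult_2[OF Alim, of "transpose A0"] A0
    unfolding B_def[abs_def] by (simp add: orthogonal_matrix_def)
  have Gn: "((Re (w' (r n)), Im (w' (r n)), z' (r n), d' (r n)), B n, e (r n) * e0) \<in> G" for n
    using mult_mem[OF G[of "r n"] inv] by (simp add: B_def matrix_vector_mult_def sum_2)
  have "orthogonal_matrix (B n)" for n
    unfolding B_def using carr A0 by (intro orthogonal_matrix_mul) (auto simp: orthogonal_matrix_transpose)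
  with B have "\<forall>\<^sub>F n in sequentially. rotation_matrix (B n)"
    by (rule det_orthogonal_eventually_1)
  moreover have "\<forall>\<^sub>F n in sequentially. e (r n) * e0 = 1"
  proof -
    have "(\<lambda>n. e (r n) * e0) \<longlonglongrightarrow> e0 * e0"
      by (intro tendsto_intros elim)
    then have "(\<lambda>n. e (r n) * e0) \<longlonglongrightarrow> 1"
      using e0 by auto
    then have "\<forall>\<^sub>F n in sequentially. e (r n) * e0 > 0"
      by (rule order_tendstoD) simp
    then show ?thesis
    proof eventually_elim
      case (elim n)
      then show ?case using e0 carr(2)[of "r n"] by auto
    qed
  qed
  ultimately have "\<forall>\<^sub>F n in sequentially. motion (w' (r n)) (z' (r n)) (d' (r n)) (\<theta> n) \<in> G"
  proof eventually_elim
    case (elim n)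
    have "B n = rotm (\<theta> n)"
      unfolding \<theta>_def by (rule rotation_matrix_2_Arg[OF elim(1)])
    with elim(2) Gn[of n] show ?case
      by (simp add: motion_def)
  qed
  then obtain N where N: "\<And>n. n \<ge> N \<Longrightarrow> motion (w' (r n)) (z' (r n)) (d' (r n)) (\<theta> n) \<in> G"
    unfolding eventually_sequentially by blast
  have "(\<lambda>n. Complex (B n $ 1 $ 1) (B n $ 2 $ 1)) \<longlonglongrightarrow> Complex ((mat 1 :: real^2^2) $ 1 $ 1) ((mat 1 :: real^2^2) $ 2 $ 1)"
    by (intro tendsto_intros tendsto_vec_nth B)
  moreover have "Complex ((mat 1 :: real^2^2) $ 1 $ 1) ((mat 1 :: real^2^2) $ 2 $ 1) = 1"
    by (simp add: mat_def complex_eq_iff)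
  ultimately have lim1: "(\<lambda>n. Complex (B n $ 1 $ 1) (B n $ 2 $ 1)) \<longlonglongrightarrow> 1"
    by simp
  \<comment> \<open>The branch cut of \<open>Arg\<close> is the negative real axis, so the angles
    follow the matrices continuously near the identity.\<close>
  have "isCont Arg 1"
    by (rule continuous_at_Arg) simp
  from isCont_tendsto_compose[OF this lim1] have "\<theta> \<longlonglongrightarrow> Arg 1"
    unfolding \<theta>_def[abs_def] .
  then have \<theta>: "\<theta> \<longlonglongrightarrow> 0"
    by simp
  \<comment> \<open>Shifting by \<open>N\<close> turns a membership that held eventually into one
    for all indices.\<close>
  have r': "strict_mono (\<lambda>n. r (n + N))"
    using r by (simp add: strict_mono_def)
  show ?thesis
  proof (rule lie_limit_rotation)
    show "motion (w' (r (n + N))) (z' (r (n + N))) (d' (r (n + N))) (\<theta> (n + N)) \<in> G" for n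
      by (rule N) simp
    show "filterlim (\<lambda>n. m (r (n + N))) at_top sequentially"
      by (rule filterlim_compose[OF m filterlim_subseq[OF r']])
    show "(\<lambda>n. \<theta> (n + N)) \<longlonglongrightarrow> 0"
      by (rule LIMSEQ_ignore_initial_segment[OF \<theta>])
  qed (use LIMSEQ_subseq_LIMSEQ[OF w r'] LIMSEQ_subseq_LIMSEQ[OF z r']
      LIMSEQ_subseq_LIMSEQ[OF d r'] in \<open>simp_all add: o_def\<close>)
qed

section \<open>Subalgebras over a hyperplane: the four cases\<close>

lemma lie_diff_scale:
  assumes "lie w z d l" "lie w' z' d' l'"
  shows "lie (w - of_real c * w') (z - c * z') (d - c * d') (l - c * l')"
  using lie_add[OF assms(1) lie_scale[OF assms(2), of "-c"]] by simp

text \<open>The bracket sends the translation u to (d + i l) u. As l is nonzero, d + i l is not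
  real, so both translations together form a real basis of the plane.\<close>

lemma lie_full_plane:
  assumes u: "lie u 0 0 0" "u \<noteq> 0" and w: "lie w z d l" "l \<noteq> 0"
  shows "lie v 0 0 0"
proof -
  have b: "lie (Complex d l * u) 0 0 0"
    using lie_bracket[OF w(1) u(1)] by (simp flip: zero_complex.code)
  \<comment> \<open>\<open>a\<close> and \<open>b\<close> are the coordinates of v / u in the real
    basis 1, d + i l.\<close>
  define b where "b = Im (v / u) / l"
  define a where "a = Re (v / u) - b * d"
  have "v / u = of_real a + of_real b * Complex d l"
    using w(2) by (simp add: complex_eq_iff a_def b_def)
  then have "v = of_real a * u + of_real b * (Complex d l * u)"
    using u(2) by (simp add: field_simps)
  with lie_add[OF lie_scale[OF u(1), of a] lie_scale[OF b, of b]] show ?thesis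
    by simp
qed

text \<open>The angular velocities l1, l2 attached to the directions 1 and i cancel in l2 times the
  first minus l1 times the second. Unless both vanish this is a nonzero pure translation, and
  whichever l1 or l2 is nonzero provides the rotation for \<open>lie_full_plane\<close>.\<close>

lemma lie_plane:
  assumes "\<And>w. \<exists>l. lie w 0 0 l"
  shows "lie v 0 0 0"
proof -
  obtain l1 l2 where l: "lie 1 0 0 l1" "lie \<i> 0 0 l2"
    using assms by meson
  show ?thesis
  proof (cases "l1 = 0 \<and> l2 = 0")
    case True
    moreover have "v = of_real (Re v) * 1 + of_real (Im v) * \<i>"
      by (simp add: complex_eq_iff)
    ultimately show ?thesis
      using lie_add[OF lie_scale[OF l(1), of "Re v"] lie_scale[OF l(2), of "Im v"]] by simp
  next
    case False
    have "lie (of_real l2 - of_real l1 * \<i>) 0 0 0"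
      using lie_diff_scale[OF lie_scale[OF l(1), of l2] l(2), of l1] by simp
    moreover have "of_real l2 - of_real l1 * \<i> \<noteq> 0"
      using False by (auto simp: complex_eq_iff)
    ultimately show ?thesis
      using lie_full_plane[of _ 1 0 0 l1] lie_full_plane[of _ \<i> 0 0 l2] l False by blast
  qed
qed

text \<open>The split follows the position of the hyperplane relative to the coordinate directions.
  When the hyperplane does not contain all horizontal directions, having a horizontal translation
  and an angular velocity at once would restore the full plane and lead to (B). What escapes is (C),
  where no rotation is involved, and (D), where no horizontal translation arises.\<close>

lemma lie_cases:
  fixes n1 n2 n3 n4 :: real
  assumes n: "\<And>w z d. n1 * Re w + n2 * Im w + n3 * z + n4 * d = 0 \<Longrightarrow> \<exists>l. lie w z d l"
  obtains
    (A) l where "\<And>w. lie w 0 0 0" "lie 0 1 0 l"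
  | (B) z0 l0 where "\<And>w. lie w 0 0 0" "lie 0 z0 1 l0"
  | (C) u w0 where "u \<noteq> 0" "lie u 0 0 0" "lie 0 1 0 0" "lie w0 0 1 0"
  | (D) w0 where "w0 \<noteq> 0" "lie 0 1 0 0" "lie w0 0 1 0" "lie (\<i> * w0) 0 0 1"
proof (cases "n1 = 0 \<and> n2 = 0 \<and> n3 = 0")
  case True
  then have "\<exists>l. lie w z 0 l" for w z
    by (intro n) simp
  then obtain l where "lie 0 1 0 l" and "\<And>w. lie w 0 0 0"
    using lie_plane by blast
  then show ?thesis
    by (intro that(1))
next
  case False
  note caseB = that(2)
  define N where "N = n1^2 + n2^2 + n3^2"
  have "N \<noteq> 0"
    using False unfolding N_def by (smt (verit) power2_less_eq_zero_iff zero_le_power2)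
  \<comment> \<open>The multiple of (n1, n2, n3) for which the vector with t-component 1 lies in the
    hyperplane.\<close>
  define w0 where "w0 = Complex (- n4 * n1 / N) (- n4 * n2 / N)"
  define z0 where "z0 = - n4 * n3 / N"
  have "n1 * Re w0 + n2 * Im w0 + n3 * z0 + n4 * 1 = - n4 * (n1^2 + n2^2 + n3^2) / N + n4"
    unfolding w0_def z0_def using \<open>N \<noteq> 0\<close> by (simp add: field_simps power2_eq_square)
  also have "\<dots> = 0"
    using \<open>N \<noteq> 0\<close> by (simp flip: N_def)
  finally obtain l0 where \<tau>: "lie w0 z0 1 l0"
    using n by blast
  \<comment> \<open>Once all horizontal translations are available, the horizontal part of the
    vector over the t-direction can be subtracted.\<close>
  have B': thesis if full: "\<And>w. lie w 0 0 0"
  proof (rule caseB[OF full])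
    show "lie 0 z0 1 l0"
      using lie_diff_scale[OF \<tau> full, of 1 w0] by simp
  qed
  show ?thesis
  proof (cases "n1 = 0 \<and> n2 = 0")
    case True
    show ?thesis
      by (rule B', rule lie_plane, rule n) (use True in simp)
  next
    case False
    \<comment> \<open>\<open>u\<close> spans the horizontal directions of the hyperplane, and
      \<open>v\<close> is the horizontal multiple of (n1, n2) that puts the vector with z-component
      1 into it.\<close>
    define u where "u = Complex (- n2) n1"
    define m where "m = n1^2 + n2^2"
    define v where "v = Complex (- n3 * n1 / m) (- n3 * n2 / m)"
    have u0: "u \<noteq> 0"
      using False by (auto simp: u_def complex_eq_iff)
    have "m \<noteq> 0"
      using False unfolding m_def by (simp add: sum_power2_eq_zero_iff)
    then have "n1 * Re v + n2 * Im v + n3 = - n3 * (n1^2 + n2^2) / m + n3"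
      unfolding v_def by (simp add: field_simps power2_eq_square)
    also have "\<dots> = 0"
      using \<open>m \<noteq> 0\<close> by (simp flip: m_def)
    finally obtain \<nu> where v: "lie v 1 0 \<nu>"
      using n[of v 1 0] by auto
    obtain \<mu> where u: "lie u 0 0 \<mu>"
      using n[of u 0 0] by (auto simp: u_def)
    show ?thesis
    proof (cases "\<mu> = 0")
      case True
      with u have u: "lie u 0 0 0" by simp
      show ?thesis
      proof (cases "\<nu> = 0 \<and> l0 = 0")
        case True
        \<comment> \<open>The bracket multiplies the horizontal part by 1 and the z-part by -2.
          Subtracting it from (v, 1) kills the horizontal part and leaves 1 - (-2) = 3 in the
          z-direction, whence the factor 1/3.\<close>
        have "lie v (-2) 0 0"
          using lie_bracket[OF \<tau> v] True by (simp flip: one_complex.code zero_complex.code)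
        from lie_scale[OF lie_diff_scale[OF v this, of 1], of "1/3"] have z: "lie 0 1 0 0"
          using True by simp
        have "lie w0 0 1 0"
          using lie_diff_scale[OF \<tau> z, of z0] True by simp
        with u0 u z that(3) show ?thesis by blast
      next
        case False
        then show ?thesis
          using B' lie_full_plane[OF u u0] v \<tau> by blast
      qed
    next
      case False
      \<comment> \<open>Scaled to angular velocity 1, the vector over \<open>u\<close> serves to
        subtract the rotations from the vectors over the t- and z-directions.\<close>
      define w1 where "w1 = of_real (1 / \<mu>) * u"
      define w2 where "w2 = w0 - of_real l0 * w1"
      define c where "c = v - of_real \<nu> * w1"
      have \<eta>: "lie w1 0 0 1"
        using lie_scale[OF u, of "1/\<mu>"] False unfolding w1_def by simp
      have \<tau>': "lie w2 z0 1 0"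
        using lie_diff_scale[OF \<tau> \<eta>, of l0] unfolding w2_def by simp
      have c1: "lie c 1 0 0"
        using lie_diff_scale[OF v \<eta>, of \<nu>] unfolding c_def by simp
      have "lie c (-2) 0 0"
        using lie_bracket[OF \<tau>' c1] by (simp flip: one_complex.code zero_complex.code)
      from lie_scale[OF lie_diff_scale[OF c1 this, of 1], of "1/3"] have z: "lie 0 1 0 0"
        by simp
      have c: "lie c 0 0 0"
        using lie_diff_scale[OF c1 z, of 1] by simp
      have \<tau>'': "lie w2 0 1 0"
        using lie_diff_scale[OF \<tau>' z, of z0] by simp
      \<comment> \<open>The two one-parameter groups fix the horizontal points -w2 and i w1. The
        bracket vanishes exactly when these points agree, which is (D); otherwise it is a nonzero
        translation.\<close>
      have w12: "lie (w1 - \<i> * w2) 0 0 0"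
        using lie_bracket[OF \<tau>'' \<eta>] by (simp flip: one_complex.code imaginary_unit.code)
      have "w1 \<noteq> 0"
        unfolding w1_def using u0 False by simp
      show ?thesis
      proof (cases "w1 = \<i> * w2")
        case True
        with \<open>w1 \<noteq> 0\<close> \<eta> have "w2 \<noteq> 0" "lie (\<i> * w2) 0 0 1" by auto
        then show ?thesis
          using that(4) z \<tau>'' by blast
      next
        case False
        then have "w1 - \<i> * w2 \<noteq> 0" by simp
        from lie_full_plane[OF _ this \<eta>] show ?thesis
          using B' w12 by simp
      qed
    qed
  qed
qed

end


section \<open>Hypersurfaces\<close>

lemma smooth_open_differentiable:
  assumes "smooth_open f U" "x \<in> U"
  shows "f differentiable (at x)"
proof -
  have "Ck_on (Suc 0) f U"
    using assms(1) unfolding smooth_open_def by blast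
  then show ?thesis
    using assms(2) by simp
qed

lemma has_derivative_sequence:
  assumes "(f has_derivative f') (at x)"
  shows "(\<lambda>n. real (Suc n) *\<^sub>R (f (x + inverse (real (Suc n)) *\<^sub>R v) - f x)) \<longlonglongrightarrow> f' v"
proof -
  define y where "y n = x + inverse (real (Suc n)) *\<^sub>R v" for n
  have lin: "f' (c *\<^sub>R v) = c *\<^sub>R f' v" for c
    using has_derivative_bounded_linear[OF assms] by (simp add: linear_scale bounded_linear.linear)
  have "(\<lambda>n. real (Suc n) *\<^sub>R (f (y n) - f x) - f' v) \<longlonglongrightarrow> 0"
  \<comment> \<open>For v = 0 the points \<open>y n\<close> equal x and do not approach it within
    the punctured filter \<open>at x\<close>.\<close>
  proof (cases "v = 0")
    case True
    then show ?thesis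
      using lin[of 0] by (simp add: y_def)
  next
    case False
    have "y \<longlonglongrightarrow> x + 0 *\<^sub>R v"
      unfolding y_def[abs_def] by (intro tendsto_intros LIMSEQ_inverse_real_of_nat)
    then have "filterlim y (at x) sequentially"
      using False by (simp add: filterlim_at y_def)
    moreover have "((\<lambda>y. norm (f y - f x - f' (y - x)) / norm (y - x)) \<longlongrightarrow> 0) (at x)"
      using assms by (simp add: has_derivative_iff_norm)
    ultimately have "(\<lambda>n. norm (f (y n) - f x - f' (y n - x)) / norm (y n - x)) \<longlonglongrightarrow> 0"
      by (rule filterlim_compose[rotated])
    from tendsto_mult[OF this tendsto_const, of "norm v"]
    have "(\<lambda>n. norm (f (y n) - f x - f' (y n - x)) / norm (y n - x) * norm v) \<longlonglongrightarrow> 0"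
      by simp
    moreover have "norm (f (y n) - f x - f' (y n - x)) / norm (y n - x) * norm v =
        norm (real (Suc n) *\<^sub>R (f (y n) - f x) - f' v)" for n
    proof -
      define N where "N = real (Suc n)"
      have N: "N > 0" by (simp add: N_def)
      have "N *\<^sub>R (f (y n) - f x) - f' v = N *\<^sub>R (f (y n) - f x - f' (y n - x))"
        using N unfolding y_def N_def[symmetric] by (simp add: lin scaleR_diff_right)
      moreover have "norm (y n - x) = norm v / N"
        using N unfolding y_def N_def[symmetric] by (simp add: field_simps)
      ultimately show ?thesis
        using N False unfolding N_def[symmetric] by simp
    qed
    ultimately show ?thesis
      by (simp add: tendsto_norm_zero_iff)
  qed
  then show ?thesis
    unfolding y_def by (rule LIM_zero_cancel)
qed

definition slice_chart :: "R4 set \<Rightarrow> R4 \<Rightarrow> R4 set \<Rightarrow> R4 set \<Rightarrow> (R4 \<Rightarrow> R4) \<Rightarrow> (R4 \<Rightarrow> R4) \<Rightarrow> bool" where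
  "slice_chart M p U V \<phi> \<psi> \<longleftrightarrow> p \<in> U \<and> smooth_open \<phi> U \<and> smooth_open \<psi> V \<and>
     homeomorphism U V \<phi> \<psi> \<and> \<phi> ` (M \<inter> U) = V \<inter> {(a, b, c, d). d = 0}"

lemma hypersurface_chart:
  assumes "hypersurface M" "p \<in> M"
  shows "\<exists>U V \<phi> \<psi>. slice_chart M p U V \<phi> \<psi>"
proof -
  have "\<forall>p\<in>M. \<exists>U V \<phi> \<psi>. slice_chart M p U V \<phi> \<psi>"
    using assms(1) unfolding hypersurface_def slice_chart_def by (elim conjE)
  from bspec[OF this assms(2)] show ?thesis .
qed

text \<open>\<open>l\<close> is the last coordinate of the derivative of a slice chart. If it
  vanishes on v, the points of the straight line through the image of p in the direction of the
  derivative of v stay in the slice, and the inverse chart carries them to M with velocity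
  v.\<close>

lemma hypersurface_tangent:
  assumes "hypersurface M" "p \<in> M"
  obtains l :: "R4 \<Rightarrow> real" where "linear l"
    "\<And>v. l v = 0 \<Longrightarrow> \<exists>q. (\<forall>n. q n \<in> M) \<and> (\<lambda>n. real (Suc n) *\<^sub>R (q n - p)) \<longlonglongrightarrow> v"
proof -
  obtain U V \<phi> \<psi> where chart: "slice_chart M p U V \<phi> \<psi>"
    using hypersurface_chart[OF assms] by blast
  then have p: "p \<in> U" and \<phi>: "smooth_open \<phi> U" and \<psi>: "smooth_open \<psi> V"
    and hom: "homeomorphism U V \<phi> \<psi>"
    and slice: "\<phi> ` (M \<inter> U) = V \<inter> {(a, b, c, d). d = 0}"
    by (simp_all only: slice_chart_def)
  have \<phi>p: "\<phi> p \<in> V"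
    using p hom by (auto simp: homeomorphism_def)
  have open_U: "open U" and open_V: "open V"
    using \<phi> \<psi> by (auto simp: smooth_open_def)
  obtain D where D: "(\<phi> has_derivative D) (at p)"
    using smooth_open_differentiable[OF \<phi> p] by (auto simp: differentiable_def)
  obtain E where E: "(\<psi> has_derivative E) (at (\<phi> p))"
    using smooth_open_differentiable[OF \<psi> \<phi>p] by (auto simp: differentiable_def)
  have "((\<psi> \<circ> \<phi>) has_derivative (E \<circ> D)) (at p)"
    by (rule diff_chain_at[OF D E])
  moreover have "((\<psi> \<circ> \<phi>) has_derivative id) (at p)"
  proof (rule has_derivative_transform_within_open[OF has_derivative_id open_U p])
    show "id x = (\<psi> \<circ> \<phi>) x" if "x \<in> U" for x
      using that hom by (simp add: homeomorphism_def)
  qed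
  ultimately have "E \<circ> D = id"
    by (rule has_derivative_unique)
  then have ED: "E (D v) = v" for v
    by (rule pointfree_idE)
  let ?l = "\<lambda>v. snd (snd (snd (D v)))"
  show thesis
  proof (rule that)
    have "linear D"
      using has_derivative_bounded_linear[OF D] bounded_linear.linear by blast
    then show "linear ?l"
      by (simp add: linear_iff)
    fix v
    assume l: "?l v = 0"
    define y where "y n = \<phi> p + inverse (real (Suc n)) *\<^sub>R D v" for n
    \<comment> \<open>The value p is a default for the finitely many \<open>n\<close> for which the
      line has not yet entered the chart domain.\<close>
    define q where "q n = (if y n \<in> V then \<psi> (y n) else p)" for n
    have \<psi>\<phi>p: "\<psi> (\<phi> p) = p"
      using p hom by (simp add: homeomorphism_def)
    have "\<phi> p \<in> \<phi> ` (M \<inter> U)"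
      using p assms(2) by (intro imageI IntI)
    then have "snd (snd (snd (\<phi> p))) = 0"
      unfolding slice by (simp add: case_prod_unfold)
    with l have y0: "snd (snd (snd (y n))) = 0" for n
      by (simp add: y_def)
    have "\<psi> (y n) \<in> M" if "y n \<in> V" for n
    proof -
      have "y n \<in> \<phi> ` (M \<inter> U)"
        unfolding slice using that y0[of n] by (simp add: case_prod_unfold)
      then obtain x where "x \<in> M" "x \<in> U" "y n = \<phi> x"
        by (elim imageE IntE)
      moreover from this(2) have "\<psi> (\<phi> x) = x"
        using hom by (simp only: homeomorphism_def)
      ultimately show ?thesis by simp
    qed
    then have qM: "q n \<in> M" for n
      using assms(2) by (simp add: q_def)
    have "y \<longlonglongrightarrow> \<phi> p + 0 *\<^sub>R D v"
      unfolding y_def[abs_def] by (intro tendsto_intros LIMSEQ_inverse_real_of_nat)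
    then have "y \<longlonglongrightarrow> \<phi> p"
      by simp
    then have ev: "\<forall>\<^sub>F n in sequentially. y n \<in> V"
      using open_V \<phi>p by (rule topological_tendstoD)
    have "(\<lambda>n. real (Suc n) *\<^sub>R (\<psi> (y n) - p)) \<longlonglongrightarrow> v"
      using has_derivative_sequence[OF E, of "D v"] unfolding ED \<psi>\<phi>p y_def .
    then have "(\<lambda>n. real (Suc n) *\<^sub>R (q n - p)) \<longlonglongrightarrow> v"
      by (rule Lim_transform_eventually) (use ev in eventually_elim, simp add: q_def)
    with qM show "\<exists>q. (\<forall>n. q n \<in> M) \<and> (\<lambda>n. real (Suc n) *\<^sub>R (q n - p)) \<longlonglongrightarrow> v"
      by blast
  qed
qed

text \<open>
  By invariance of domain \<open>range F\<close> is open in \<open>M\<close>; it is also closed, and \<open>M\<close> is connected.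
\<close>

lemma hypersurface_eq_range:
  fixes F :: "real \<times> real \<times> real \<Rightarrow> R4"
  assumes M: "hypersurface M" and cont: "continuous_on UNIV F"
    and inj: "\<And>x. \<exists>W. open W \<and> x \<in> W \<and> inj_on F W"
    and closed: "closed (range F)" and sub: "range F \<subseteq> M"
  shows "M = range F"
proof -
  have "openin (top_of_set M) (range F)"
  proof (subst openin_subopen, intro ballI)
    fix m
    assume "m \<in> range F"
    then obtain x where x: "m = F x" by blast
    then have "m \<in> M" using sub by blast
    obtain U V \<phi> \<psi> where chart: "slice_chart M m U V \<phi> \<psi>"
      using hypersurface_chart[OF M \<open>m \<in> M\<close>] by blast
    then have p: "m \<in> U" and \<phi>: "smooth_open \<phi> U" and \<psi>: "smooth_open \<psi> V"
      and hom: "homeomorphism U V \<phi> \<psi>"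
      and slice: "\<phi> ` (M \<inter> U) = V \<inter> {(a, b, c, d). d = 0}"
      by (simp_all only: slice_chart_def)
    have open_U: "open U" and open_V: "open V"
      using \<phi> \<psi> by (auto simp: smooth_open_def)
    have cont\<phi>: "continuous_on U \<phi>" and \<psi>\<phi>: "\<And>y. y \<in> U \<Longrightarrow> \<psi> (\<phi> y) = y"
      and \<phi>V: "\<And>y. y \<in> U \<Longrightarrow> \<phi> y \<in> V"
      using hom by (auto simp: homeomorphism_def)
    define \<pi> :: "R4 \<Rightarrow> real \<times> real \<times> real" where "\<pi> v = (fst v, fst (snd v), fst (snd (snd v)))" for v
    have \<pi>_inj: "v = w" if "\<pi> v = \<pi> w" "v \<in> {(a, b, c, d). d = 0}" "w \<in> {(a, b, c, d). d = 0}" for v w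
      using that by (cases v; cases w) (simp add: \<pi>_def)
    have \<phi>_slice: "\<phi> y \<in> {(a, b, c, d). d = 0}" if "y \<in> M" "y \<in> U" for y
    proof -
      have "\<phi> y \<in> \<phi> ` (M \<inter> U)"
        using that by (intro imageI IntI)
      then show ?thesis
        unfolding slice by (rule IntD2)
    qed
    obtain W where W: "open W" "x \<in> W" "inj_on F W"
      using inj by blast
    define S where "S = W \<inter> F -` U"
    have S: "open S" "x \<in> S"
      using W p x open_vimage[OF open_U cont] unfolding S_def by (simp_all add: open_Int)
    \<comment> \<open>Read in the slice chart with the last coordinate dropped, F becomes a
      continuous injection of an open set into three-space, to which invariance of domain
      applies.\<close>
    have "inj_on (\<pi> \<circ> \<phi> \<circ> F) S"
    proof (rule inj_onI)
      fix y z
      assume yz: "y \<in> S" "z \<in> S" "(\<pi> \<circ> \<phi> \<circ> F) y = (\<pi> \<circ> \<phi> \<circ> F) z"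
      from yz(1,2) have U: "F y \<in> U" "F z \<in> U"
        unfolding S_def by simp_all
      have "F y \<in> M" "F z \<in> M"
        using subsetD[OF sub] by simp_all
      note sl = \<phi>_slice[OF this(1) U(1)] \<phi>_slice[OF this(2) U(2)]
      have "\<pi> (\<phi> (F y)) = \<pi> (\<phi> (F z))"
        using yz(3) by (simp only: o_apply)
      from arg_cong[OF \<pi>_inj[OF this sl], of \<psi>] have "F y = F z"
        by (simp only: \<psi>\<phi> U)
      then show "y = z"
        using inj_onD[OF W(3)] yz by (simp add: S_def)
    qed
    moreover have "continuous_on S (\<pi> \<circ> \<phi> \<circ> F)"
    proof (intro continuous_on_compose)
      show "continuous_on S F"
        by (rule continuous_on_subset[OF cont subset_UNIV])
      show "continuous_on (F ` S) \<phi>"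
        by (rule continuous_on_subset[OF cont\<phi>]) (auto simp: S_def)
      show "continuous_on (\<phi> ` F ` S) \<pi>"
        unfolding \<pi>_def by (intro continuous_intros)
    qed
    ultimately have op: "open ((\<pi> \<circ> \<phi> \<circ> F) ` S)"
      using S(1) by (intro invariance_of_domain)
    define O' where "O' = U \<inter> (\<pi> \<circ> \<phi>) -` ((\<pi> \<circ> \<phi> \<circ> F) ` S)"
    have "continuous_on U (\<pi> \<circ> \<phi>)"
      unfolding \<pi>_def o_def by (intro continuous_intros cont\<phi>)
    from continuous_on_open_vimage[OF open_U, THEN iffD1, OF this] op
    have "open O'"
      unfolding O'_def by (simp add: Int_commute)
    moreover have "m \<in> O'"
      using p S(2) x unfolding O'_def by auto
    moreover have "M \<inter> O' \<subseteq> range F"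
    proof
      fix y
      assume y: "y \<in> M \<inter> O'"
      then obtain s where s: "s \<in> S" "\<pi> (\<phi> y) = \<pi> (\<phi> (F s))" and "y \<in> U"
        unfolding O'_def by auto
      have "F s \<in> U" "F s \<in> M"
        using s(1) sub by (auto simp: S_def)
      then have "\<phi> y = \<phi> (F s)"
        using y \<open>y \<in> U\<close> by (intro \<pi>_inj[OF s(2) \<phi>_slice \<phi>_slice]) blast+
      from arg_cong[OF this, of \<psi>] have "y = F s"
        by (simp only: \<psi>\<phi> \<open>y \<in> U\<close> \<open>F s \<in> U\<close>)
      then show "y \<in> range F" by simp
    qed
    ultimately show "\<exists>T. openin (top_of_set M) T \<and> m \<in> T \<and> T \<subseteq> range F"
      using \<open>m \<in> M\<close> by (intro exI[of _ "M \<inter> O'"]) (auto simp: openin_open)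
  qed
  moreover have "closedin (top_of_set M) (range F)"
    using closed sub by (simp add: closed_subset)
  moreover have "connected M"
    using M by (simp add: hypersurface_def)
  ultimately show ?thesis
    unfolding connected_clopen by (auto dest!: spec[of _ "range F"])
qed

section \<open>Transport by isometries\<close>

lemma isom_inverse_ex:
  assumes "g \<in> carrier Isom"
  obtains k where "k \<in> carrier Isom" "\<And>x. isom_act k (isom_act g x) = x" "\<And>x. isom_act g (isom_act k x) = x"
proof -
  obtain k where k: "k \<in> carrier Isom" "k \<otimes>\<^bsub>Isom\<^esub> g = \<one>\<^bsub>Isom\<^esub>"
    using group.l_inv_ex[OF group_Isom assms] by blast
  have "g \<otimes>\<^bsub>Isom\<^esub> k = \<one>\<^bsub>Isom\<^esub>"
    by (rule group.inv_comm[OF group_Isom k(2) k(1) assms])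
  with k(2) have "isom_act (isom_mult k g) x = x" "isom_act (isom_mult g k) x = x" for x
    using isom_act_one by (auto simp: Isom_def simp del: isom_act.simps isom_mult.simps)
  then show thesis
    using that k(1) by (simp add: isom_act_mult)
qed

lemma continuous_on_isom_act: "continuous_on S (isom_act g)"
proof -
  obtain a1 a2 a3 s A \<epsilon> where g: "g = ((a1, a2, a3, s), A, \<epsilon>)" by (cases g) auto
  have "isom_act g = (\<lambda>p. (a1 + exp s * (A$1$1 * fst p + A$1$2 * fst (snd p)),
      a2 + exp s * (A$2$1 * fst p + A$2$2 * fst (snd p)),
      a3 + exp (-2 * s) * (\<epsilon> * fst (snd (snd p))), s + snd (snd (snd p))))"
    by (auto simp: g fun_eq_iff matrix_vector_mult_def sum_2)
  then show ?thesis
    by (simp, intro continuous_intros)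
qed

text \<open>Composing F with the inverse isometry reduces this to
  \<open>hypersurface_eq_range\<close> for M itself, so the slice charts of M serve as they
  are.\<close>

lemma isom_image_eq_range:
  fixes F :: "real \<times> real \<times> real \<Rightarrow> R4"
  assumes M: "hypersurface M" and g: "g \<in> carrier Isom"
    and cont: "continuous_on UNIV F"
    and inj: "\<And>x. \<exists>W. open W \<and> x \<in> W \<and> inj_on F W"
    and closed: "closed (range F)" and sub: "range F \<subseteq> isom_act g ` M"
  shows "isom_act g ` M = range F"
proof -
  obtain k where k: "k \<in> carrier Isom" "\<And>x. isom_act k (isom_act g x) = x" "\<And>x. isom_act g (isom_act k x) = x"
    using isom_inverse_ex[OF g] by blast
  have "M = range (isom_act k \<circ> F)"
  proof (rule hypersurface_eq_range[OF M])
    show "continuous_on UNIV (isom_act k \<circ> F)"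
      by (intro continuous_on_compose cont continuous_on_isom_act)
    show "\<exists>W. open W \<and> x \<in> W \<and> inj_on (isom_act k \<circ> F) W" for x
    proof -
      have "inj (isom_act k)"
        by (rule inj_on_inverseI) (rule k(3))
      then show ?thesis
        using inj[of x] comp_inj_on[of F _ "isom_act k"] inj_on_subset[of "isom_act k" UNIV] by blast
    qed
    have "range (isom_act k \<circ> F) = isom_act g -` range F"
    proof (intro equalityI subsetI)
      fix y
      assume "y \<in> isom_act g -` range F"
      then obtain x where "isom_act g y = F x" by auto
      then have "y = (isom_act k \<circ> F) x"
        using k(2)[of y] by (simp del: isom_act.simps)
      then show "y \<in> range (isom_act k \<circ> F)" by blast
    qed (auto simp: k(3) simp del: isom_act.simps)
    moreover have "closed (isom_act g -` range F)"
      by (intro closed_vimage closed continuous_on_isom_act)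
    ultimately show "closed (range (isom_act k \<circ> F))"
      by simp
    show "range (isom_act k \<circ> F) \<subseteq> M"
    proof (rule image_subsetI)
      fix x
      obtain m where "m \<in> M" "F x = isom_act g m"
        using sub by blast
      then show "(isom_act k \<circ> F) x \<in> M"
        by (simp add: k(2) del: isom_act.simps)
    qed
  qed
  then show ?thesis
    by (simp add: image_comp o_def k(3) del: isom_act.simps)
qed


section \<open>The model hypersurfaces\<close>

lemma sech_mult_exp:
  "exp (x + ln (sech r)) * sinh r = exp x * tanh r"
proof -
  have "sech r > 0"
    by (simp add: sech_def)
  then show ?thesis
    by (simp add: exp_add sech_def tanh_def)
qed

lemma exp_ln_sech: "exp (t - ln (sech r)) * tanh r = exp t * sinh r"
  using sech_mult_exp[of "t - ln (sech r)" r] by simp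

text \<open>The shift t = x3 + ln (sech r) turns tanh r into sinh r. In upper half-space coordinates
  (x, y, exp t) the equation describes the cone at hyperbolic distance r from the vertical geodesic.
  An equation also makes closedness evident.\<close>

lemma M1_eq:
  assumes "r > 0"
  shows "M1 r = {(x, y, z, t). x^2 + y^2 = (exp t * sinh r)^2}"
proof (intro equalityI subsetI)
  fix p
  assume "p \<in> M1 r"
  then obtain x1 x2 x3 where p: "p = (exp x3 * cos x1 * tanh r, exp x3 * sin x1 * tanh r, x2, x3 + ln (sech r))"
    unfolding M1_def by blast
  have "(exp x3 * cos x1 * tanh r)^2 + (exp x3 * sin x1 * tanh r)^2 =
      (exp x3 * tanh r)^2 * ((cos x1)^2 + (sin x1)^2)"
    by (simp only: power_mult_distrib distrib_left mult_ac)
  then show "p \<in> {(x, y, z, t). x^2 + y^2 = (exp t * sinh r)^2}"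
    by (simp only: p mem_Collect_eq prod.case sech_mult_exp sin_cos_squared_add2 mult_1_right)
next
  fix p :: R4
  assume "p \<in> {(x, y, z, t). x^2 + y^2 = (exp t * sinh r)^2}"
  then obtain x y z t where p: "p = (x, y, z, t)" and e: "x^2 + y^2 = (exp t * sinh r)^2"
    by auto
  define R where "R = exp t * sinh r"
  have R: "R > 0"
    using assms by (simp add: R_def)
  have "R \<noteq> 0" "x^2 + y^2 = R^2"
    using R e by (auto simp: R_def)
  then have "(x / R)^2 + (y / R)^2 = 1"
    by (simp add: power_divide flip: add_divide_distrib)
  then obtain \<theta> where "x / R = cos \<theta>" "y / R = sin \<theta>"
    by (rule sincos_total_2pi)
  then have xy: "x = R * cos \<theta>" "y = R * sin \<theta>"
    using R by (simp_all add: field_simps)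
  have h: "R = exp (t - ln (sech r)) * tanh r"
    by (simp only: exp_ln_sech R_def)
  have "p = (exp (t - ln (sech r)) * cos \<theta> * tanh r, exp (t - ln (sech r)) * sin \<theta> * tanh r,
      z, (t - ln (sech r)) + ln (sech r))"
    unfolding p xy h by (simp only: diff_add_cancel mult_ac)
  then show "p \<in> M1 r"
    unfolding M1_def by blast
qed

lemma M2_eq: "M2 r = {(x, y, z, t). y = exp t * sinh r}"
proof (intro equalityI subsetI)
  fix p :: R4
  assume "p \<in> {(x, y, z, t). y = exp t * sinh r}"
  then obtain x z t where "p = (x, exp (t - ln (sech r)) * tanh r, z, (t - ln (sech r)) + ln (sech r))"
    by (auto simp: exp_ln_sech)
  then show "p \<in> M2 r"
    unfolding M2_def by blast
qed (auto simp: M2_def sech_mult_exp)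

lemma cosh_mult_exp: "exp (-2 * (x + 1/2 * ln (cosh (2 * r)))) * sinh (2 * r) = exp (-2 * x) * tanh (2 * r)"
  for x r :: real
proof -
  have "-2 * (x + 1/2 * ln (cosh (2 * r))) = -2 * x - ln (cosh (2 * r))"
    by simp
  then show ?thesis
    by (simp only: exp_diff) (simp add: tanh_def)
qed

text \<open>In the coordinates (2 z, exp (-2 t)) the metric of the zt-plane is that of the
  hyperbolic half-plane with lengths halved. The quotient of these coordinates is sinh (2 r), that
  is distance r from the line z = 0; this explains the factors 2 and 1/2.\<close>

lemma M3_eq: "M3 r = {(x, y, z, t). z = 1/2 * exp (-2 * t) * sinh (2 * r)}"
proof (intro equalityI subsetI)
  fix p
  assume "p \<in> M3 r"
  then obtain x y t where p: "p = (x, y, 1/2 * exp (-2 * t) * tanh (2 * r), t + 1/2 * ln (cosh (2 * r)))"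
    unfolding M3_def by blast
  show "p \<in> {(x, y, z, t). z = 1/2 * exp (-2 * t) * sinh (2 * r)}"
    unfolding p using cosh_mult_exp[of t r] by (simp only: mem_Collect_eq prod.case mult.assoc)
next
  fix p :: R4
  assume "p \<in> {(x, y, z, t). z = 1/2 * exp (-2 * t) * sinh (2 * r)}"
  then obtain x y t where p: "p = (x, y, 1/2 * exp (-2 * t) * sinh (2 * r), t)"
    by auto
  define s where "s = t - 1/2 * ln (cosh (2 * r))"
  have "t = s + 1/2 * ln (cosh (2 * r))"
    by (simp add: s_def)
  then have "p = (x, y, 1/2 * exp (-2 * s) * tanh (2 * r), s + 1/2 * ln (cosh (2 * r)))"
    unfolding p using cosh_mult_exp[of s r] by (simp only: mult.assoc)
  then show "p \<in> M3 r"
    unfolding M3_def by blast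
qed

lemma M40_eq: "M40 = {(x, y, z, t). t = 0}"
  by (auto simp: M40_def)

section \<open>From containment of a model to equality\<close>

lemma isom_image_eq_M1:
  assumes "hypersurface M" "g \<in> carrier Isom" "r > 0" "M1 r \<subseteq> isom_act g ` M"
  shows "isom_act g ` M = M1 r"
proof -
  define F :: "real \<times> real \<times> real \<Rightarrow> R4" where
    "F v = (exp (snd (snd v)) * cos (fst v) * tanh r, exp (snd (snd v)) * sin (fst v) * tanh r,
            fst (snd v), snd (snd v) + ln (sech r))" for v
  have range: "range F = M1 r"
  proof (intro equalityI subsetI)
    fix p assume "p \<in> M1 r"
    then obtain x1 x2 x3 where "p = F (x1, x2, x3)"
      unfolding M1_def F_def by auto
    then show "p \<in> range F" by blast
  qed (auto simp: M1_def F_def)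
  have "isom_act g ` M = range F"
  proof (rule isom_image_eq_range[OF assms(1,2)])
    show "continuous_on UNIV F"
      unfolding F_def by (intro continuous_intros)
    show "closed (range F)"
      unfolding range M1_eq[OF assms(3)] case_prod_unfold
      by (intro closed_Collect_eq continuous_intros)
    show "range F \<subseteq> isom_act g ` M"
      using assms(4) range by simp
    \<comment> \<open>The angle makes F periodic, so it is injective only locally. The angle window
      has length 2, less than the period 2 pi.\<close>
    show "\<exists>W. open W \<and> x \<in> W \<and> inj_on F W" for x
    proof (intro exI conjI)
      show "open (fst -` {fst x - 1<..<fst x + 1} :: (real \<times> real \<times> real) set)"
        by (intro open_vimage_fst) simp
      show "inj_on F (fst -` {fst x - 1<..<fst x + 1})"
      proof (rule inj_onI)
        fix v w
        assume v: "v \<in> fst -` {fst x - 1<..<fst x + 1}" and w: "w \<in> fst -` {fst x - 1<..<fst x + 1}"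
          and e: "F v = F w"
        have 3: "snd (snd v) = snd (snd w)" and 2: "fst (snd v) = fst (snd w)"
          using e by (simp_all add: F_def)
        have "tanh r \<noteq> 0"
          using assms(3) by simp
        then have "cos (fst v) = cos (fst w)" "sin (fst v) = sin (fst w)"
          using e 3 by (simp_all add: F_def)
        then obtain k :: int where k: "fst v = fst w + 2 * pi * k"
          using sin_cos_eq_iff[of "fst v" "fst w"] by blast
        have "\<bar>fst v - fst w\<bar> < 2"
          using v w by auto
        then have "2 * pi * \<bar>real_of_int k\<bar> < 2"
          unfolding k by (simp add: abs_mult)
        moreover have "2 * pi > 2"
          using pi_gt3 by simp
        ultimately have "2 * pi * \<bar>real_of_int k\<bar> < 2 * pi * 1"
          by linarith
        then have "\<bar>real_of_int k\<bar> < 1"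
          using pi_gt_zero by (simp only: mult_less_cancel_left_pos)
        then have "k = 0"
          by linarith
        then show "v = w"
          using k 2 3 by (simp add: prod_eq_iff)
      qed
    qed simp
  qed
  then show ?thesis
    using range by simp
qed

lemma isom_image_eq_M2:
  assumes "hypersurface M" "g \<in> carrier Isom" "M2 r \<subseteq> isom_act g ` M"
  shows "isom_act g ` M = M2 r"
proof -
  define F :: "real \<times> real \<times> real \<Rightarrow> R4" where
    "F v = (fst v, exp (snd (snd v)) * sinh r, fst (snd v), snd (snd v))" for v
  have range: "range F = M2 r"
  proof (intro equalityI subsetI)
    fix p assume "p \<in> M2 r"
    then obtain x z t where "p = F (x, z, t)"
      unfolding M2_eq F_def by auto
    then show "p \<in> range F" by blast
  qed (auto simp: M2_eq F_def)
  have "isom_act g ` M = range F"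
  proof (rule isom_image_eq_range[OF assms(1,2)])
    show "continuous_on UNIV F"
      unfolding F_def by (intro continuous_intros)
    show "closed (range F)"
      unfolding range M2_eq case_prod_unfold
      by (intro closed_Collect_eq continuous_intros)
    show "range F \<subseteq> isom_act g ` M"
      using assms(3) range by simp
    have "inj F"
      by (auto simp: inj_def F_def)
    then show "\<exists>W. open W \<and> x \<in> W \<and> inj_on F W" for x
      by (intro exI[of _ UNIV]) simp
  qed
  then show ?thesis
    using range by simp
qed

lemma isom_image_eq_M3:
  assumes "hypersurface M" "g \<in> carrier Isom" "M3 r \<subseteq> isom_act g ` M"
  shows "isom_act g ` M = M3 r"
proof -
  define F :: "real \<times> real \<times> real \<Rightarrow> R4" where
    "F v = (fst v, fst (snd v), 1/2 * exp (-2 * snd (snd v)) * sinh (2 * r), snd (snd v))" for v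
  have range: "range F = M3 r"
  proof (intro equalityI subsetI)
    fix p assume "p \<in> M3 r"
    then obtain x y t where "p = F (x, y, t)"
      unfolding M3_eq F_def by auto
    then show "p \<in> range F" by blast
  qed (auto simp: M3_eq F_def)
  have "isom_act g ` M = range F"
  proof (rule isom_image_eq_range[OF assms(1,2)])
    show "continuous_on UNIV F"
      unfolding F_def by (intro continuous_intros)
    show "closed (range F)"
      unfolding range M3_eq case_prod_unfold
      by (intro closed_Collect_eq continuous_intros)
    show "range F \<subseteq> isom_act g ` M"
      using assms(3) range by simp
    have "inj F"
      by (auto simp: inj_def F_def)
    then show "\<exists>W. open W \<and> x \<in> W \<and> inj_on F W" for x
      by (intro exI[of _ UNIV]) simp
  qed
  then show ?thesis
    using range by simp
qed

lemma isom_image_eq_M40: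
  assumes "hypersurface M" "g \<in> carrier Isom" "M40 \<subseteq> isom_act g ` M"
  shows "isom_act g ` M = M40"
proof -
  define F :: "real \<times> real \<times> real \<Rightarrow> R4" where
    "F v = (fst v, fst (snd v), snd (snd v), 0)" for v
  have range: "range F = M40"
  proof (intro equalityI subsetI)
    fix p assume "p \<in> M40"
    then obtain x y z where "p = F (x, y, z)"
      unfolding M40_eq F_def by auto
    then show "p \<in> range F" by blast
  qed (auto simp: M40_eq F_def)
  have "isom_act g ` M = range F"
  proof (rule isom_image_eq_range[OF assms(1,2)])
    show "continuous_on UNIV F"
      unfolding F_def by (intro continuous_intros)
    show "closed (range F)"
      unfolding range M40_eq case_prod_unfold
      by (intro closed_Collect_eq continuous_intros)
    show "range F \<subseteq> isom_act g ` M"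
      using assms(3) range by simp
    have "inj F"
      by (auto simp: inj_def F_def)
    then show "\<exists>W. open W \<and> x \<in> W \<and> inj_on F W" for x
      by (intro exI[of _ UNIV]) simp
  qed
  then show ?thesis
    using range by simp
qed

section \<open>Models inside the orbits\<close>

lemma isom_act_motion:
  "isom_act (motion w z t a) (x, y, z', t') =
    (Re (w + exp (Complex t a) * Complex x y), Im (w + exp (Complex t a) * Complex x y),
     z + exp (-2 * t) * z', t + t')"
  by (simp add: motion_def matrix_vector_mult_def sum_2 Re_exp Im_exp algebra_simps)

context closed_isom_subgroup
begin

lemma orbitI:
  assumes "motion w z t a \<in> G"
  shows "(Re w, Im w, z, t) \<in> isom_orbit G (0, 0, 0, 0)"
proof -
  have "isom_act (motion w z t a) (0, 0, 0, 0) \<in> isom_orbit G (0, 0, 0, 0)"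
    unfolding orbit_def mem_Collect_eq by (rule exI[of _ "motion w z t a"]) (simp add: assms)
  then show ?thesis
    by (simp only: isom_act_motion_0)
qed

lemma translation_mem: "lie w 0 0 0 \<Longrightarrow> motion w 0 0 0 \<in> G"
  using expm_mem[of w 0 0 0] by (simp add: expm_def flip: zero_complex.code)

lemma flow_mem: "lie w z d l \<Longrightarrow> expm (of_real s * w) (s * z) (s * d) (s * l) \<in> G"
  by (simp add: lie_def)

text \<open>Horizontally this flow is the dilation by exp t about its fixed point -w, which moves
  the origin to w (exp t - 1).\<close>

lemma flow_w_mem:
  assumes "lie w 0 1 0"
  shows "motion (w * (exp (of_real t) - 1)) 0 t 0 \<in> G"
proof -
  have C: "Complex t 0 = of_real t"
    by (simp add: complex_eq_iff)
  have "of_real t * w * exprel (of_real t) = w * (of_real t * exprel (of_real t))"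
    by (simp only: mult_ac)
  then have e: "of_real t * w * exprel (of_real t) = w * (exp (of_real t) - 1)"
    by (simp only: mult_exprel)
  have "motion (of_real t * w * exprel (of_real t)) 0 t 0 \<in> G"
    using flow_mem[OF assms, of t] by (simp add: expm_def C)
  then show ?thesis
    by (simp only: e)
qed

text \<open>The vertical flow may rotate with angular velocity l, but it acts first, on the origin,
  where the rotation is invisible.\<close>

lemma M40_subset_orbit:
  assumes "\<And>w. lie w 0 0 0" "lie 0 1 0 l"
  shows "M40 \<subseteq> isom_orbit G (0, 0, 0, 0)"
proof
  fix p
  assume "p \<in> M40"
  then obtain x y z where p: "p = (x, y, z, 0)"
    unfolding M40_def by blast
  have "isom_mult (motion (Complex x y) 0 0 0) (expm (of_real z * 0) (z * 1) (z * 0) (z * l)) \<in> G"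
    by (intro mult_mem translation_mem flow_mem assms)
  then have "motion (Complex x y) z 0 (z * l) \<in> G"
    unfolding expm_def isom_mult_motion by simp
  from orbitI[OF this] show "p \<in> isom_orbit G (0, 0, 0, 0)"
    by (simp add: p)
qed

lemma M3_subset_orbit:
  assumes "\<And>w. lie w 0 0 0" "lie 0 z0 1 l"
  shows "\<exists>g\<in>carrier Isom. \<exists>r\<ge>0. M3 r \<subseteq> isom_act g ` isom_orbit G (0, 0, 0, 0)"
proof -
  \<comment> \<open>The flow over the t-direction moves the origin to height z0 (exp (-2 t) - 1) /
    (-2) = c exp (-2 t) - c. Translation by c removes the constant, the sign \<open>e\<close> makes
    the height nonnegative, and \<open>r\<close> solves sinh (2 r) / 2 = |c|.\<close>
  define c where "c = - z0 / 2"
  define e :: real where "e = (if c \<ge> 0 then 1 else -1)"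
  define r where "r = arsinh (2 * \<bar>c\<bar>) / 2"
  have e: "e * c = \<bar>c\<bar>" "e = 1 \<or> e = -1" "e * e = 1"
    by (auto simp: e_def)
  define g :: sol_isometry where "g = ((0, 0, e * c, 0), mat 1, e)"
  have gI: "g \<in> carrier Isom"
    using e(2) by (auto simp: g_def Isom_def orthogonal_matrix_id)
  have sinh_r: "sinh (2 * r) = 2 * \<bar>c\<bar>"
    by (simp add: r_def sinh_arsinh_real)
  moreover have "r \<ge> 0"
    using sinh_real_nonneg_iff[of "2 * r"] by (simp add: sinh_r)
  moreover have "M3 r \<subseteq> isom_act g ` isom_orbit G (0, 0, 0, 0)"
  proof
    fix p
    assume "p \<in> M3 r"
    then obtain x y t where p: "p = (x, y, 1/2 * exp (-2 * t) * sinh (2 * r), t)"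
      unfolding M3_eq by auto
    have "isom_mult (motion (Complex x y) 0 0 0) (expm (of_real t * 0) (t * z0) (t * 1) (t * l)) \<in> G"
      by (intro mult_mem translation_mem flow_mem assms)
    moreover have "t * z0 * exprel (-2 * t) = c * exp (-2 * t) - c"
    proof -
      have "t * z0 * exprel (-2 * t) = c * (-2 * t * exprel (-2 * t))"
        by (simp add: c_def)
      then show ?thesis
        unfolding mult_exprel by (simp add: algebra_simps)
    qed
    ultimately have "motion (Complex x y) (c * exp (-2 * t) - c) t (t * l) \<in> G"
      unfolding expm_def isom_mult_motion by simp
    from orbitI[OF this] have "(x, y, c * exp (-2 * t) - c, t) \<in> isom_orbit G (0, 0, 0, 0)"
      by simp
    moreover have "isom_act g (x, y, c * exp (-2 * t) - c, t) = (x, y, e * c * exp (-2 * t), t)"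
      by (simp add: g_def algebra_simps)
    ultimately show "p \<in> isom_act g ` isom_orbit G (0, 0, 0, 0)"
      using e(1) sinh_r by (intro image_eqI[of _ _ "(x, y, c * exp (-2 * t) - c, t)"]) (simp_all add: p mult.commute)
  qed
  ultimately show ?thesis using gI by (intro bexI[of _ g] exI[of _ r] conjI)
qed

text \<open>The isometry turns u into the positive x-direction, then moves the fixed point of the
  dilation flow to the origin. There the flow multiplies the offset \<zeta> by exp t, and
  translations along u absorb its real part. A reflection makes the imaginary part nonnegative, and
  this part is sinh r.\<close>

lemma M2_subset_orbit:
  assumes u: "u \<noteq> 0" "lie u 0 0 0" and z: "lie 0 1 0 0" and w: "lie w 0 1 0"
  shows "\<exists>g\<in>carrier Isom. \<exists>r\<ge>0. M2 r \<subseteq> isom_act g ` isom_orbit G (0, 0, 0, 0)"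
proof -
  define a where "a = - Arg u"
  define \<zeta> where "\<zeta> = cis a * w"
  define e :: real where "e = (if Im \<zeta> \<ge> 0 then 1 else -1)"
  define r where "r = arsinh \<bar>Im \<zeta>\<bar>"
  have e: "e * Im \<zeta> = \<bar>Im \<zeta>\<bar>" "e = 1 \<or> e = -1"
    by (auto simp: e_def)
  define \<rho> :: sol_isometry where "\<rho> = ((0, 0, 0, 0), vector [vector [1, 0], vector [0, e]], 1)"
  have "orthogonal_matrix (vector [vector [1, 0], vector [0, e]] :: real^2^2)"
    using e(2) by (auto simp: orthogonal_matrix_2_iff)
  then have \<rho>: "\<rho> \<in> carrier Isom"
    by (simp add: \<rho>_def Isom_def)
  define g where "g = isom_mult \<rho> (motion \<zeta> 0 0 a)"
  have "\<rho> \<otimes>\<^bsub>Isom\<^esub> motion \<zeta> 0 0 a \<in> carrier Isom"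
    by (intro monoid.m_closed[OF group.is_monoid[OF group_Isom]] \<rho> motion_in_Isom)
  then have gI: "g \<in> carrier Isom"
    by (simp add: g_def Isom_def)
  have sinh_r: "sinh r = \<bar>Im \<zeta>\<bar>"
    by (simp add: r_def sinh_arsinh_real)
  moreover have "r \<ge> 0"
    using sinh_real_nonneg_iff[of r] by (simp add: sinh_r)
  moreover have "M2 r \<subseteq> isom_act g ` isom_orbit G (0, 0, 0, 0)"
  proof
    fix p
    assume "p \<in> M2 r"
    then obtain x z t where p: "p = (x, exp t * sinh r, z, t)"
      unfolding M2_eq by auto
    \<comment> \<open>The multiple of \<open>u\<close> that brings the first coordinate to
      x.\<close>
    define s where "s = (x - exp t * Re \<zeta>) / cmod u"
    define v where "v = of_real s * u + w * (exp (of_real t) - 1)"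
    have "isom_mult (isom_mult (motion (of_real s * u) 0 0 0) (expm (of_real z * 0) (z * 1) (z * 0) (z * 0)))
        (motion (w * (exp (of_real t) - 1)) 0 t 0) \<in> G"
      using lie_scale[OF u(2), of s] assms by (intro mult_mem translation_mem flow_mem flow_w_mem) simp_all
    then have "motion v z t 0 \<in> G"
      unfolding expm_def isom_mult_motion v_def by (simp flip: zero_complex.code)
    note orb = orbitI[OF this]
    have "cis a * u = of_real (cmod u)"
    proof -
      have "u = of_real (cmod u) * cis (Arg u)"
        using u(1) by (simp add: cis_Arg sgn_eq)
      from arg_cong[OF this, of "\<lambda>x. cis a * x"]
      have "cis a * u = of_real (cmod u) * (cis a * cis (Arg u))"
        by (simp only: mult.left_commute)
      then show ?thesis
        by (simp add: a_def cis_mult)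
    qed
    then have "\<zeta> + cis a * v = of_real (s * cmod u) + of_real (exp t) * \<zeta>"
      by (simp add: v_def \<zeta>_def algebra_simps exp_of_real)
    moreover have "s * cmod u = x - exp t * Re \<zeta>"
      using u(1) by (simp add: s_def)
    ultimately have \<zeta>v: "Re (\<zeta> + cis a * v) = x" "Im (\<zeta> + cis a * v) = exp t * Im \<zeta>"
      by simp_all
    have "isom_act (motion \<zeta> 0 0 a) (Re v, Im v, z, t) = (x, exp t * Im \<zeta>, z, t)"
    proof -
      have "exp (Complex 0 a) = cis a"
        unfolding cis_conv_exp by (rule arg_cong[of _ _ exp]) (simp add: complex_eq_iff)
      then show ?thesis
        using \<zeta>v by (simp only: isom_act_motion complex_surj) simp
    qed
    then have "isom_act g (Re v, Im v, z, t) = (x, e * (exp t * Im \<zeta>), z, t)"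
      unfolding g_def isom_act_mult by (simp only:) (simp add: \<rho>_def matrix_vector_mult_def sum_2)
    moreover have "e * (exp t * Im \<zeta>) = exp t * sinh r"
      using e(1) by (simp add: sinh_r mult.left_commute)
    ultimately have "p = isom_act g (Re v, Im v, z, t)"
      by (simp only: p)
    then show "p \<in> isom_act g ` isom_orbit G (0, 0, 0, 0)"
      using orb by (rule image_eqI)
  qed
  ultimately show ?thesis using gI by (intro bexI[of _ g] exI[of _ r] conjI)
qed

text \<open>Dilation and rotation have the common fixed point -w. After translating it to the
  origin, the horizontal part of the orbit consists of the points exp (t + i s) w, a circle of
  radius exp t |w| over each t, so sinh r = |w|.\<close>

lemma M1_subset_orbit:
  assumes w0: "w \<noteq> 0" and z: "lie 0 1 0 0" and w: "lie w 0 1 0" and rot: "lie (\<i> * w) 0 0 1"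
  shows "\<exists>g\<in>carrier Isom. \<exists>r>0. M1 r \<subseteq> isom_act g ` isom_orbit G (0, 0, 0, 0)"
proof -
  define r where "r = arsinh (cmod w)"
  define g where "g = motion w 0 0 0"
  have gI: "g \<in> carrier Isom"
    unfolding g_def by (rule motion_in_Isom)
  have sinh_r: "sinh r = cmod w"
    by (simp add: r_def sinh_arsinh_real)
  moreover have r: "r > 0"
    using sinh_real_pos_iff[of r] w0 by (simp add: sinh_r)
  moreover have "M1 r \<subseteq> isom_act g ` isom_orbit G (0, 0, 0, 0)"
  proof
    fix p
    assume "p \<in> M1 r"
    then obtain x y z t where p: "p = (x, y, z, t)" and xy: "x^2 + y^2 = (exp t * sinh r)^2"
      unfolding M1_eq[OF r] by auto
    \<comment> \<open>The complex factor carrying w to the target point; its modulus is exp t and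
      its argument is the required angle.\<close>
    define q where "q = Complex x y / w"
    have "cmod (Complex x y) = exp t * cmod w"
      using xy by (simp add: cmod_def sinh_r)
    then have cq: "cmod q = exp t"
      using w0 by (simp add: q_def norm_divide)
    define s where "s = Arg q"
    have "q \<noteq> 0"
      using cq by auto
    then have "q = of_real (exp t) * cis s"
      using cq by (simp add: s_def cis_Arg sgn_eq)
    then have q: "exp (of_real t) * cis s = Complex x y / w"
      by (simp add: q_def exp_of_real)
    have "expm (of_real s * (\<i> * w)) (s * 0) (s * 0) (s * 1) \<in> G"
      by (rule flow_mem[OF rot])
    moreover have "of_real s * (\<i> * w) * exprel (Complex 0 s) = w * (cis s - 1)"
    proof -
      have C: "Complex 0 s = \<i> * of_real s"
        by (simp add: complex_eq_iff)
      have "of_real s * (\<i> * w) * exprel (Complex 0 s) = w * (\<i> * of_real s * exprel (\<i> * of_real s))"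
        unfolding C by (simp only: mult_ac)
      then show ?thesis
        unfolding mult_exprel by (simp only: cis_conv_exp)
    qed
    ultimately have rot_mem: "motion (w * (cis s - 1)) 0 0 s \<in> G"
      by (simp add: expm_def)
    have C: "Complex t 0 = of_real t"
      by (simp add: complex_eq_iff)
    from mult_mem[OF mult_mem[OF flow_mem[OF z, of z] flow_w_mem[OF w, of t]] rot_mem]
    have "motion (w * (exp (of_real t) - 1) + exp (of_real t) * (w * (cis s - 1))) z t s \<in> G"
      unfolding expm_def isom_mult_motion by (simp add: C flip: zero_complex.code)
    moreover have "w * (exp (of_real t) - 1) + exp (of_real t) * (w * (cis s - 1)) = Complex x y - w"
    proof -
      have "w * (exp (of_real t) - 1) + exp (of_real t) * (w * (cis s - 1)) = w * (exp (of_real t) * cis s) - w"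
        by (simp add: algebra_simps)
      then show ?thesis
        using w0 by (simp add: q)
    qed
    ultimately have "motion (Complex x y - w) z t s \<in> G"
      by simp
    note orb = orbitI[OF this]
    have "exp (Complex 0 0) = 1"
      by (simp flip: zero_complex.code)
    then have "isom_act g (Re (Complex x y - w), Im (Complex x y - w), z, t) = p"
      unfolding g_def isom_act_motion complex_surj by (simp only: p) simp
    from this[symmetric] orb show "p \<in> isom_act g ` isom_orbit G (0, 0, 0, 0)"
      by (rule image_eqI)
  qed
  ultimately show ?thesis using gI by (intro bexI[of _ g] exI[of _ r] conjI)
qed

end


section \<open>The model groups\<close>

lemma Ck_on_const: "Ck_on k (\<lambda>x. c) UNIV"
  by (induction k arbitrary: c) simp_all

text \<open>The derivative in a fixed direction does not depend on the point, so every higher order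
  reduces to constant functions.\<close>

lemma smooth_open_affine:
  assumes "bounded_linear f"
  shows "smooth_open (\<lambda>x. f x + c) UNIV"
proof -
  have D: "((\<lambda>x. f x + c) has_derivative f) (at x)" for x
    by (intro has_derivative_add_const bounded_linear_imp_has_derivative assms)
  have "frechet_derivative (\<lambda>x. f x + c) (at x) = f" for x
    using frechet_derivative_at[OF D] ..
  then have "Ck_on k (\<lambda>x. f x + c) UNIV" for k
    using D linear_continuous_on[OF assms, of UNIV]
    by (cases k) (auto simp: Ck_on_const differentiable_def intro: continuous_on_add)
  then show ?thesis
    by (simp add: smooth_open_def)
qed

lemma smooth_map_on_affine:
  assumes "bounded_linear F" "\<And>x. x \<in> S \<Longrightarrow> f x = F x + c"
  shows "smooth_map_on f S"
  unfolding smooth_map_on_def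
proof
  fix x assume "x \<in> S"
  show "\<exists>U F. x \<in> U \<and> smooth_open F U \<and> (\<forall>y\<in>S \<inter> U. F y = f y)"
    by (rule exI[of _ UNIV], rule exI[of _ "\<lambda>x. F x + c"])
      (simp add: smooth_open_affine assms)
qed

text \<open>The model isomorphisms only drop constant coordinates. The inverse must restore them,
  hence a linear map plus the constant c.\<close>

lemma lie_isomorphic_affine:
  assumes L: "bounded_linear L" "\<And>x. x \<in> carrier G \<Longrightarrow> L x \<in> carrier H"
    and K: "bounded_linear K" "\<And>y. y \<in> carrier H \<Longrightarrow> K y + c \<in> carrier G"
    and KL: "\<And>x. x \<in> carrier G \<Longrightarrow> K (L x) + c = x"
    and LK: "\<And>y. y \<in> carrier H \<Longrightarrow> L (K y + c) = y"
    and hom: "\<And>x y. x \<in> carrier G \<Longrightarrow> y \<in> carrier G \<Longrightarrow> L (x \<otimes>\<^bsub>G\<^esub> y) = L x \<otimes>\<^bsub>H\<^esub> L y"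
  shows "G \<cong>\<^sub>L H"
proof -
  have bij: "bij_betw L (carrier G) (carrier H)"
    by (rule bij_betw_byWitness[where f' = "\<lambda>y. K y + c"]) (auto simp: L K KL LK)
  then have "L \<in> iso G H"
    using L hom by (auto simp: iso_def hom_def)
  moreover have "smooth_map_on L (carrier G)"
    by (rule smooth_map_on_affine[OF L(1), where c = 0]) simp
  moreover have "smooth_map_on (inv_into (carrier G) L) (carrier H)"
  proof (rule smooth_map_on_affine[OF K(1)])
    fix y
    assume "y \<in> carrier H"
    then show "inv_into (carrier G) L y = K y + c"
      using bij by (intro inv_into_f_eq K LK) (simp add: bij_betw_def)
  qed
  ultimately show ?thesis
    unfolding lie_isomorphic_def by (intro bexI[of _ L] conjI)
qed

section \<open>The subgroups and their isomorphism types\<close>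

lemma inv_Sol04: "inv\<^bsub>Sol04\<^esub> (x, y, z, t) = (- exp (-t) * x, - exp (-t) * y, - exp (2 * t) * z, -t)"
proof (rule group.inv_equality[OF group_Sol04])
  show "(- exp (-t) * x, - exp (-t) * y, - exp (2 * t) * z, -t) \<otimes>\<^bsub>Sol04\<^esub> (x, y, z, t) = \<one>\<^bsub>Sol04\<^esub>"
    by (simp add: Sol04_def)
qed (simp_all add: Sol04_def)

lemma subgroup_Sol04I:
  assumes "(0, 0, 0, 0) \<in> H" "\<And>a b. a \<in> H \<Longrightarrow> b \<in> H \<Longrightarrow> sol_mult a b \<in> H"
    and "\<And>x y z t. (x, y, z, t) \<in> H \<Longrightarrow> (- exp (-t) * x, - exp (-t) * y, - exp (2 * t) * z, -t) \<in> H"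
  shows "subgroup H Sol04"
proof (rule group.subgroupI[OF group_Sol04])
  show "inv\<^bsub>Sol04\<^esub> a \<in> H" if "a \<in> H" for a
    using that assms(3) by (cases a) (simp add: inv_Sol04)
  show "H \<noteq> {}"
    using assms(1) by blast
qed (simp_all add: Sol04_def assms(2))

lemma subgroup_H2: "subgroup H2 Sol04"
  by (rule subgroup_Sol04I) (auto simp: H2_def)

lemma subgroup_H3: "subgroup H3 Sol04"
  by (rule subgroup_Sol04I) (auto simp: H3_def)

lemma subgroup_H4: "subgroup H4 Sol04"
  by (rule subgroup_Sol04I) (auto simp: H4_def)

lemma subgroup_H1: "subgroup H1 Isom"
proof (rule group.subgroupI[OF group_Isom])
  show "H1 \<subseteq> carrier Isom"
    by (auto simp: H1_def Isom_def rotation_matrix_def)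
  have "((0, 0, 0, 0), mat 1, 1) \<in> H1"
    by (simp add: H1_def rotation_matrix_def orthogonal_matrix_id)
  then show "H1 \<noteq> {}"
    by blast
next
  fix g
  assume "g \<in> H1"
  then obtain z t A where g: "g = ((0, 0, z, t), A, 1)" and A: "rotation_matrix A"
    unfolding H1_def by blast
  let ?h = "((0, 0, - exp (2 * t) * z, -t), transpose A, 1) :: sol_isometry"
  have "inv\<^bsub>Isom\<^esub> g = ?h"
  proof (rule group.inv_equality[OF group_Isom])
    show "?h \<otimes>\<^bsub>Isom\<^esub> g = \<one>\<^bsub>Isom\<^esub>"
      using A by (simp add: g Isom_def rotation_matrix_def orthogonal_matrix_def matrix_vector_mult_def sum_2)
  qed (use A in \<open>auto simp: g Isom_def rotation_matrix_def orthogonal_matrix_transpose\<close>)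
  moreover have "rotation_matrix (transpose A)"
    using A by (simp add: rotation_matrix_def orthogonal_matrix_transpose)
  ultimately show "inv\<^bsub>Isom\<^esub> g \<in> H1"
    by (simp add: H1_def)
next
  fix g h
  assume "g \<in> H1" "h \<in> H1"
  then obtain z t A z' t' A' where g: "g = ((0, 0, z, t), A, 1)" and h: "h = ((0, 0, z', t'), A', 1)"
    and A: "rotation_matrix A" "rotation_matrix A'"
    unfolding H1_def by blast
  then have "rotation_matrix (A ** A')"
    by (simp add: rotation_matrix_def orthogonal_matrix_mul det_mul)
  then show "g \<otimes>\<^bsub>Isom\<^esub> h \<in> H1"
    by (simp add: g h H1_def Isom_def matrix_vector_mult_def sum_2)
qed

lemma lie_isomorphic_H1: "Isom\<lparr>carrier := H1\<rparr> \<cong>\<^sub>L semidirect_real (\<lambda>t x. \<theta>1 t * x) \<times>\<times> SO2"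
proof (rule lie_isomorphic_affine)
  let ?L = "\<lambda>p :: sol_isometry. (snd (snd (fst p)), fst (snd p))"
  \<comment> \<open>The reflection sign is set to 0 to keep \<open>?K\<close> linear; the constant
    added later restores the value 1.\<close>
  let ?K = "\<lambda>q :: (real \<times> real) \<times> (real^2^2). (((0, 0, fst q), snd q, 0) :: sol_isometry)"
  show "bounded_linear ?L" "bounded_linear ?K"
    by (intro linear_conv_bounded_linear[THEN iffD1] linearI; simp)+
  show "?L x \<in> carrier (semidirect_real (\<lambda>t x. \<theta>1 t * x) \<times>\<times> SO2)"
    if "x \<in> carrier (Isom\<lparr>carrier := H1\<rparr>)" for x
    using that by (auto simp: H1_def semidirect_real_def SO2_def)
  show "?K y + ((0, 0, 0, 0), 0, 1) \<in> carrier (Isom\<lparr>carrier := H1\<rparr>)"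
    if "y \<in> carrier (semidirect_real (\<lambda>t x. \<theta>1 t * x) \<times>\<times> SO2)" for y
    using that by (auto simp: H1_def semidirect_real_def SO2_def)
  show "?K (?L x) + ((0, 0, 0, 0), 0, 1) = x" if "x \<in> carrier (Isom\<lparr>carrier := H1\<rparr>)" for x
    using that by (auto simp: H1_def)
  show "?L (?K y + ((0, 0, 0, 0), 0, 1)) = y" for y
    by (cases y) (simp add: zero_prod_def)
  show "?L (x \<otimes>\<^bsub>Isom\<lparr>carrier := H1\<rparr>\<^esub> y) = ?L x \<otimes>\<^bsub>semidirect_real (\<lambda>t x. \<theta>1 t * x) \<times>\<times> SO2\<^esub> ?L y"
    if "x \<in> carrier (Isom\<lparr>carrier := H1\<rparr>)" "y \<in> carrier (Isom\<lparr>carrier := H1\<rparr>)" for x y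
    using that by (auto simp: H1_def Isom_def semidirect_real_def SO2_def \<theta>1_def)
qed

lemma lie_isomorphic_H2: "Sol04\<lparr>carrier := H2\<rparr> \<cong>\<^sub>L semidirect_real (\<lambda>t v. \<theta>2 t *v v)"
proof (rule lie_isomorphic_affine)
  let ?L = "\<lambda>p :: R4. (vector [fst p, fst (snd (snd p))] :: real^2, snd (snd (snd p)))"
  let ?K = "\<lambda>q :: (real^2) \<times> real. ((fst q $ 1, 0, fst q $ 2, snd q) :: R4)"
  show "bounded_linear ?L" "bounded_linear ?K"
    by (intro linear_conv_bounded_linear[THEN iffD1] linearI; simp add: vec_eq_iff forall_2)+
  show "?L x \<in> carrier (semidirect_real (\<lambda>t v. \<theta>2 t *v v))" for x
    by (simp add: semidirect_real_def)
  show "?K y + 0 \<in> carrier (Sol04\<lparr>carrier := H2\<rparr>)" for y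
    by (simp add: H2_def)
  show "?K (?L x) + 0 = x" if "x \<in> carrier (Sol04\<lparr>carrier := H2\<rparr>)" for x
    using that by (auto simp: H2_def)
  show "?L (?K y + 0) = y" for y
    by (cases y) (simp add: vec_eq_iff forall_2)
  show "?L (x \<otimes>\<^bsub>Sol04\<lparr>carrier := H2\<rparr>\<^esub> y) = ?L x \<otimes>\<^bsub>semidirect_real (\<lambda>t v. \<theta>2 t *v v)\<^esub> ?L y"
    if "x \<in> carrier (Sol04\<lparr>carrier := H2\<rparr>)" "y \<in> carrier (Sol04\<lparr>carrier := H2\<rparr>)" for x y
    using that by (auto simp: H2_def Sol04_def semidirect_real_def \<theta>2_def vec_eq_iff forall_2
        matrix_vector_mult_def sum_2)
qed

lemma lie_isomorphic_H3: "Sol04\<lparr>carrier := H3\<rparr> \<cong>\<^sub>L semidirect_real (\<lambda>t v. \<theta>3 t *v v)"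
proof (rule lie_isomorphic_affine)
  let ?L = "\<lambda>p :: R4. (vector [fst p, fst (snd p)] :: real^2, snd (snd (snd p)))"
  let ?K = "\<lambda>q :: (real^2) \<times> real. ((fst q $ 1, fst q $ 2, 0, snd q) :: R4)"
  show "bounded_linear ?L" "bounded_linear ?K"
    by (intro linear_conv_bounded_linear[THEN iffD1] linearI; simp add: vec_eq_iff forall_2)+
  show "?L x \<in> carrier (semidirect_real (\<lambda>t v. \<theta>3 t *v v))" for x
    by (simp add: semidirect_real_def)
  show "?K y + 0 \<in> carrier (Sol04\<lparr>carrier := H3\<rparr>)" for y
    by (simp add: H3_def)
  show "?K (?L x) + 0 = x" if "x \<in> carrier (Sol04\<lparr>carrier := H3\<rparr>)" for x
    using that by (auto simp: H3_def)
  show "?L (?K y + 0) = y" for y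
    by (cases y) (simp add: vec_eq_iff forall_2)
  show "?L (x \<otimes>\<^bsub>Sol04\<lparr>carrier := H3\<rparr>\<^esub> y) = ?L x \<otimes>\<^bsub>semidirect_real (\<lambda>t v. \<theta>3 t *v v)\<^esub> ?L y"
    if "x \<in> carrier (Sol04\<lparr>carrier := H3\<rparr>)" "y \<in> carrier (Sol04\<lparr>carrier := H3\<rparr>)" for x y
    using that by (auto simp: H3_def Sol04_def semidirect_real_def \<theta>3_def vec_eq_iff forall_2
        matrix_vector_mult_def sum_2)
qed

lemma lie_isomorphic_H4: "Sol04\<lparr>carrier := H4\<rparr> \<cong>\<^sub>L additive_R3"
proof (rule lie_isomorphic_affine)
  let ?L = "\<lambda>p :: R4. (vector [fst p, fst (snd p), fst (snd (snd p))] :: real^3)"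
  let ?K = "\<lambda>q :: real^3. ((q $ 1, q $ 2, q $ 3, 0) :: R4)"
  show "bounded_linear ?L" "bounded_linear ?K"
    by (intro linear_conv_bounded_linear[THEN iffD1] linearI; simp add: vec_eq_iff forall_3)+
  show "?L x \<in> carrier additive_R3" for x
    by (simp add: additive_R3_def)
  show "?K y + 0 \<in> carrier (Sol04\<lparr>carrier := H4\<rparr>)" for y
    by (simp add: H4_def)
  show "?K (?L x) + 0 = x" if "x \<in> carrier (Sol04\<lparr>carrier := H4\<rparr>)" for x
    using that by (auto simp: H4_def)
  show "?L (?K y + 0) = y" for y
    by (simp add: vec_eq_iff forall_3)
  show "?L (x \<otimes>\<^bsub>Sol04\<lparr>carrier := H4\<rparr>\<^esub> y) = ?L x \<otimes>\<^bsub>additive_R3\<^esub> ?L y"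
    if "x \<in> carrier (Sol04\<lparr>carrier := H4\<rparr>)" "y \<in> carrier (Sol04\<lparr>carrier := H4\<rparr>)" for x y
    using that by (auto simp: H4_def Sol04_def additive_R3_def vec_eq_iff forall_3)
qed

section \<open>The models as orbits\<close>

lemma isom_orbit_eq: "isom_orbit G p = (\<lambda>g. isom_act g p) ` G"
proof -
  have "carrier (Isom\<lparr>carrier := G\<rparr>) = G"
    by simp
  then show ?thesis
    by (simp only: orbit_def Setcompr_eq_image)
qed

lemma isom_act_translation: "isom_act (a, mat 1, 1) p = sol_mult a p"
  by (cases p) simp

lemma isom_orbit_left_translations: "isom_orbit (left_translations H) p = (\<lambda>a. sol_mult a p) ` H"
  by (simp only: isom_orbit_eq left_translations_def image_image isom_act_translation)

lemma M2_orbit: "M2 r = isom_orbit (left_translations H2) (0, tanh r, 0, ln (sech r))"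
  unfolding isom_orbit_left_translations
proof (intro equalityI subsetI)
  fix p
  assume "p \<in> M2 r"
  then obtain x z t where "p = sol_mult (x, 0, z, t) (0, tanh r, 0, ln (sech r))"
    unfolding M2_def by auto
  then show "p \<in> (\<lambda>a. sol_mult a (0, tanh r, 0, ln (sech r))) ` H2"
    unfolding H2_def by blast
qed (auto simp: M2_def H2_def)

lemma M3_orbit:
  "M3 r = isom_orbit (left_translations H3) (0, 0, 1/2 * tanh (2 * r), 1/2 * ln (cosh (2 * r)))"
  unfolding isom_orbit_left_translations
proof (intro equalityI subsetI)
  fix p
  assume "p \<in> M3 r"
  then obtain x y t where "p = sol_mult (x, y, 0, t) (0, 0, 1/2 * tanh (2 * r), 1/2 * ln (cosh (2 * r)))"
    unfolding M3_def by auto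
  then show "p \<in> (\<lambda>a. sol_mult a (0, 0, 1/2 * tanh (2 * r), 1/2 * ln (cosh (2 * r)))) ` H3"
    unfolding H3_def by blast
qed (auto simp: M3_def H3_def)

lemma M40_orbit: "M40 = isom_orbit (left_translations H4) (0, 0, 0, 0)"
  unfolding isom_orbit_left_translations
proof (intro equalityI subsetI)
  fix p
  assume "p \<in> M40"
  then obtain x y z where "p = sol_mult (x, y, z, 0) (0, 0, 0, 0)"
    unfolding M40_def by auto
  then show "p \<in> (\<lambda>a. sol_mult a (0, 0, 0, 0)) ` H4"
    unfolding H4_def by blast
qed (auto simp: M40_def H4_def)

lemma M1_orbit: "M1 r = isom_orbit H1 (tanh r, 0, 0, ln (sech r))"
proof -
  have act: "isom_act ((0, 0, z, t), A, 1) (tanh r, 0, 0, ln (sech r)) =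
      (exp t * A $ 1 $ 1 * tanh r, exp t * A $ 2 $ 1 * tanh r, z, t + ln (sech r))" for z t A
    by (simp add: matrix_vector_mult_def sum_2)
  show ?thesis
    unfolding isom_orbit_eq
  proof (intro equalityI subsetI)
    fix p
    assume "p \<in> M1 r"
    then obtain x1 x2 x3 where
      p: "p = (exp x3 * cos x1 * tanh r, exp x3 * sin x1 * tanh r, x2, x3 + ln (sech r))"
      unfolding M1_def by blast
    have "p = isom_act ((0, 0, x2, x3), rotm x1, 1) (tanh r, 0, 0, ln (sech r))"
      unfolding act p by simp
    moreover have "((0, 0, x2, x3), rotm x1, 1) \<in> H1"
      by (simp add: H1_def rotation_matrix_rotm)
    ultimately show "p \<in> (\<lambda>g. isom_act g (tanh r, 0, 0, ln (sech r))) ` H1"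
      by (rule image_eqI)
  next
    fix p
    assume "p \<in> (\<lambda>g. isom_act g (tanh r, 0, 0, ln (sech r))) ` H1"
    then obtain z t A where A: "rotation_matrix A"
      and p: "p = isom_act ((0, 0, z, t), A, 1) (tanh r, 0, 0, ln (sech r))"
      unfolding H1_def by blast
    obtain \<theta> where "A = rotm \<theta>"
      using rotation_matrix_2_Arg[OF A] by blast
    then have "p = (exp t * cos \<theta> * tanh r, exp t * sin \<theta> * tanh r, z, t + ln (sech r))"
      unfolding p act by simp
    then show "p \<in> M1 r"
      unfolding M1_def by blast
  qed
qed


section \<open>The classification\<close>

lemma closed_carrier_Isom: "closed (carrier Isom)"
  unfolding Isom_def partial_object.select_convs
  by (intro closed_Times compact_imp_closed[OF compact_orthogonal_matrices_2] finite_imp_closed closed_UNIV) simp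

text \<open>Projections replace pattern matching and the matrix product is spelled out, so that
  continuity can be read off componentwise.\<close>

lemma isom_mult_eq:
  "isom_mult g h =
    ((fst (fst g) + exp (snd (snd (snd (fst g)))) *
        (fst (snd g) $ 1 $ 1 * fst (fst h) + fst (snd g) $ 1 $ 2 * fst (snd (fst h))),
      fst (snd (fst g)) + exp (snd (snd (snd (fst g)))) *
        (fst (snd g) $ 2 $ 1 * fst (fst h) + fst (snd g) $ 2 $ 2 * fst (snd (fst h))),
      fst (snd (snd (fst g))) + exp (-2 * snd (snd (snd (fst g)))) * (snd (snd g) * fst (snd (snd (fst h)))),
      snd (snd (snd (fst g))) + snd (snd (snd (fst h)))),
     \<chi> i j. fst (snd g) $ i $ 1 * fst (snd h) $ 1 $ j + fst (snd g) $ i $ 2 * fst (snd h) $ 2 $ j,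
     snd (snd g) * snd (snd h))"
proof -
  obtain a1 a2 a3 s A e where g: "g = ((a1, a2, a3, s), A, e)" by (cases g) auto
  obtain b1 b2 b3 t B d where h: "h = ((b1, b2, b3, t), B, d)" by (cases h) auto
  show ?thesis
    by (simp add: g h matrix_vector_mult_def matrix_matrix_mult_def sum_2)
qed

lemma continuous_on_isom_mult:
  assumes "continuous_on S f" "continuous_on S f'"
  shows "continuous_on S (\<lambda>x. isom_mult (f x) (f' x))"
  unfolding isom_mult_eq
  by (intro continuous_intros continuous_on_vec_lambda assms)

text \<open>For k inverse to h this is h G k, written as a preimage of G so that closedness follows
  from continuity.\<close>

definition isom_conjugate :: "sol_isometry \<Rightarrow> sol_isometry \<Rightarrow> sol_isometry set \<Rightarrow> sol_isometry set" where
  "isom_conjugate h k G = {x \<in> carrier Isom. isom_mult k (isom_mult x h) \<in> G}"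

lemma closed_isom_subgroup_conjugate:
  assumes G: "closed_isom_subgroup G" and h: "h \<in> carrier Isom" and k: "k \<in> carrier Isom"
    and hk: "isom_mult h k = \<one>\<^bsub>Isom\<^esub>"
  shows "closed_isom_subgroup (isom_conjugate h k G)"
proof -
  interpret closed_isom_subgroup G by (rule G)
  interpret Isom: group Isom by (rule group_Isom)
  have [simp]: "isom_mult x y = x \<otimes>\<^bsub>Isom\<^esub> y" for x y
    by (simp add: Isom_def)
  have kinv: "k = inv\<^bsub>Isom\<^esub> h"
    using hk h k Isom.inv_equality[OF Isom.inv_comm[OF _ h k] h k] by simp
  show ?thesis
  proof (rule closed_isom_subgroup.intro)
    show "subgroup (isom_conjugate h k G) Isom"
    proof (rule Isom.subgroupI)
      show "isom_conjugate h k G \<subseteq> carrier Isom"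
        by (auto simp: isom_conjugate_def)
      have "\<one>\<^bsub>Isom\<^esub> \<in> isom_conjugate h k G"
        using h one_mem by (simp add: isom_conjugate_def kinv)
      then show "isom_conjugate h k G \<noteq> {}"
        by blast
    next
      fix x
      assume "x \<in> isom_conjugate h k G"
      then have x: "x \<in> carrier Isom" "k \<otimes>\<^bsub>Isom\<^esub> (x \<otimes>\<^bsub>Isom\<^esub> h) \<in> G"
        by (simp_all add: isom_conjugate_def)
      have "inv\<^bsub>Isom\<^esub> (k \<otimes>\<^bsub>Isom\<^esub> (x \<otimes>\<^bsub>Isom\<^esub> h)) = k \<otimes>\<^bsub>Isom\<^esub> (inv\<^bsub>Isom\<^esub> x \<otimes>\<^bsub>Isom\<^esub> h)"
        using x(1) h by (simp add: kinv Isom.inv_mult_group Isom.m_assoc)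
      with subgroup.m_inv_closed[OF subgr x(2)] x(1) show "inv\<^bsub>Isom\<^esub> x \<in> isom_conjugate h k G"
        by (simp add: isom_conjugate_def)
    next
      fix x y
      assume "x \<in> isom_conjugate h k G" "y \<in> isom_conjugate h k G"
      then have x: "x \<in> carrier Isom" "k \<otimes>\<^bsub>Isom\<^esub> (x \<otimes>\<^bsub>Isom\<^esub> h) \<in> G"
        and y: "y \<in> carrier Isom" "k \<otimes>\<^bsub>Isom\<^esub> (y \<otimes>\<^bsub>Isom\<^esub> h) \<in> G"
        by (simp_all add: isom_conjugate_def)
      have "(k \<otimes>\<^bsub>Isom\<^esub> (x \<otimes>\<^bsub>Isom\<^esub> h)) \<otimes>\<^bsub>Isom\<^esub> (k \<otimes>\<^bsub>Isom\<^esub> (y \<otimes>\<^bsub>Isom\<^esub> h)) =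
          k \<otimes>\<^bsub>Isom\<^esub> ((x \<otimes>\<^bsub>Isom\<^esub> y) \<otimes>\<^bsub>Isom\<^esub> h)"
        using x(1) y(1) h
        by (simp add: kinv Isom.m_assoc Isom.inv_solve_left' flip: Isom.m_assoc[of h "inv\<^bsub>Isom\<^esub> h"])
      with subgroup.m_closed[OF subgr x(2) y(2)] x(1) y(1)
      show "x \<otimes>\<^bsub>Isom\<^esub> y \<in> isom_conjugate h k G"
        by (simp add: isom_conjugate_def)
    qed
    have "isom_conjugate h k G = carrier Isom \<inter> (\<lambda>x. isom_mult k (isom_mult x h)) -` G"
      by (auto simp: isom_conjugate_def)
    moreover have "closed ((\<lambda>x. isom_mult k (isom_mult x h)) -` G)"
      by (intro closed_vimage closed continuous_on_isom_mult continuous_intros)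
    ultimately show "closed (isom_conjugate h k G)"
      by (simp only: closed_Int closed_carrier_Isom)
  qed
qed

lemma isom_orbit_conjugate:
  assumes G: "G \<subseteq> carrier Isom" and h: "h \<in> carrier Isom" and k: "k \<in> carrier Isom"
    and hk: "isom_mult h k = \<one>\<^bsub>Isom\<^esub>"
  shows "isom_orbit (isom_conjugate h k G) (isom_act h p) = isom_act h ` isom_orbit G p"
proof -
  interpret Isom: group Isom by (rule group_Isom)
  have mult: "isom_mult x y = x \<otimes>\<^bsub>Isom\<^esub> y" for x y
    by (simp add: Isom_def)
  have kinv: "k = inv\<^bsub>Isom\<^esub> h"
    using hk h k Isom.inv_equality[OF Isom.inv_comm[OF _ h k] h k] by (simp add: mult)
  show ?thesis
    unfolding isom_orbit_eq
  proof (intro equalityI subsetI)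
    fix q
    assume "q \<in> (\<lambda>g. isom_act g (isom_act h p)) ` isom_conjugate h k G"
    then obtain x where x: "x \<in> carrier Isom" "k \<otimes>\<^bsub>Isom\<^esub> (x \<otimes>\<^bsub>Isom\<^esub> h) \<in> G"
      and q: "q = isom_act x (isom_act h p)"
      by (auto simp: isom_conjugate_def mult simp del: isom_act.simps)
    have "h \<otimes>\<^bsub>Isom\<^esub> (k \<otimes>\<^bsub>Isom\<^esub> (x \<otimes>\<^bsub>Isom\<^esub> h)) = x \<otimes>\<^bsub>Isom\<^esub> h"
      using x(1) h by (simp add: kinv flip: Isom.m_assoc)
    then have "q = isom_act h (isom_act (k \<otimes>\<^bsub>Isom\<^esub> (x \<otimes>\<^bsub>Isom\<^esub> h)) p)"
      unfolding q isom_act_mult[symmetric] mult by (simp only:)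
    with x(2) show "q \<in> isom_act h ` (\<lambda>g. isom_act g p) ` G"
      by blast
  next
    fix q
    assume "q \<in> isom_act h ` (\<lambda>g. isom_act g p) ` G"
    then obtain g where g: "g \<in> G" and q: "q = isom_act h (isom_act g p)"
      by blast
    then have gc: "g \<in> carrier Isom"
      using G by blast
    define x where "x = h \<otimes>\<^bsub>Isom\<^esub> (g \<otimes>\<^bsub>Isom\<^esub> k)"
    have xh: "x \<otimes>\<^bsub>Isom\<^esub> h = h \<otimes>\<^bsub>Isom\<^esub> g"
      using h gc by (simp add: x_def kinv Isom.m_assoc)
    have "k \<otimes>\<^bsub>Isom\<^esub> (x \<otimes>\<^bsub>Isom\<^esub> h) = g"
      unfolding xh using h gc by (simp add: kinv flip: Isom.m_assoc)
    then have "x \<in> isom_conjugate h k G"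
      using g h k gc by (simp add: isom_conjugate_def mult x_def)
    moreover have "q = isom_act x (isom_act h p)"
      unfolding q isom_act_mult[symmetric] mult xh ..
    ultimately show "q \<in> (\<lambda>g. isom_act g (isom_act h p)) ` isom_conjugate h k G"
      by blast
  qed
qed

lemma sol_mult_diff:
  "sol_mult a q - sol_mult a p =
    (exp (snd (snd (snd a))) * fst (q - p), exp (snd (snd (snd a))) * fst (snd (q - p)),
     exp (-2 * snd (snd (snd a))) * fst (snd (snd (q - p))), snd (snd (snd (q - p))))"
  by (cases a; cases p; cases q) (simp add: algebra_simps)

lemma (in closed_isom_subgroup) orbit_contains_model:
  fixes n1 n2 n3 n4 :: real
  assumes n: "\<forall>x y z d. n1 * x + n2 * y + n3 * z + n4 * d = 0 \<longrightarrow>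
      (\<exists>q. (\<forall>n. q n \<in> isom_orbit G (0, 0, 0, 0)) \<and> (\<lambda>n. real (Suc n) *\<^sub>R q n) \<longlonglongrightarrow> (x, y, z, d))"
  shows "\<exists>g\<in>carrier Isom.
    (\<exists>r>0. M1 r \<subseteq> isom_act g ` isom_orbit G (0, 0, 0, 0)) \<or>
    (\<exists>r\<ge>0. M2 r \<subseteq> isom_act g ` isom_orbit G (0, 0, 0, 0)) \<or>
    (\<exists>r\<ge>0. M3 r \<subseteq> isom_act g ` isom_orbit G (0, 0, 0, 0)) \<or>
    M40 \<subseteq> isom_act g ` isom_orbit G (0, 0, 0, 0)"
proof -
  have lie_ex: "\<exists>l. lie w z d l" if nw: "n1 * Re w + n2 * Im w + n3 * z + n4 * d = 0" for w z d
  proof -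
    obtain q where q: "\<And>n. q n \<in> isom_orbit G (0, 0, 0, 0)"
      and lim: "(\<lambda>n. real (Suc n) *\<^sub>R q n) \<longlonglongrightarrow> (Re w, Im w, z, d)"
      using n[rule_format, OF nw] by blast
    define x y z' d' where "x n = fst (q n)" and "y n = fst (snd (q n))"
      and "z' n = fst (snd (snd (q n)))" and "d' n = snd (snd (snd (q n)))" for n
    have q_eq: "q n = (x n, y n, z' n, d' n)" for n
      by (simp add: x_def y_def z'_def d'_def)
    \<comment> \<open>An isometry maps the origin to its own translation part, so an orbit point
      becomes an element of \<open>G\<close> once the linear part and the sign are supplied.\<close>
    have "\<exists>Ae. (q n, Ae) \<in> G" for n
    proof -
      obtain g where "g \<in> G" "q n = isom_act g (0, 0, 0, 0)"
        using q[of n] unfolding isom_orbit_eq by (elim imageE)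
      moreover have "isom_act g (0, 0, 0, 0) = fst g"
        by (cases g) (auto simp: matrix_vector_mult_def sum_2)
      ultimately show ?thesis
        by (intro exI[of _ "snd g"]) (simp del: isom_act.simps)
    qed
    then have "\<forall>n. \<exists>Ae. (q n, Ae) \<in> G"
      by (rule allI)
    from choice[OF this] obtain Ae where Ae: "\<forall>n. (q n, Ae n) \<in> G"
      by (elim exE)
    have mem: "((Re (Complex (x n) (y n)), Im (Complex (x n) (y n)), z' n, d' n), fst (Ae n), snd (Ae n)) \<in> G" for n
      using spec[OF Ae, of n] unfolding q_eq by simp
    have lims: "(\<lambda>n. real (Suc n) * x n) \<longlonglongrightarrow> Re w" "(\<lambda>n. real (Suc n) * y n) \<longlonglongrightarrow> Im w"
      "(\<lambda>n. real (Suc n) * z' n) \<longlonglongrightarrow> z" "(\<lambda>n. real (Suc n) * d' n) \<longlonglongrightarrow> d"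
      using tendsto_fst[OF lim] tendsto_fst[OF tendsto_snd[OF lim]]
        tendsto_fst[OF tendsto_snd[OF tendsto_snd[OF lim]]] tendsto_snd[OF tendsto_snd[OF tendsto_snd[OF lim]]]
      by (simp_all add: x_def y_def z'_def d'_def)
    have to0: "f \<longlonglongrightarrow> 0" if "(\<lambda>n. real (Suc n) * f n) \<longlonglongrightarrow> a" for f a
    proof -
      have "(\<lambda>n. inverse (real (Suc n)) * (real (Suc n) * f n)) \<longlonglongrightarrow> 0 * a"
        by (intro tendsto_mult LIMSEQ_inverse_real_of_nat that)
      moreover have "inverse (real (Suc n)) * (real (Suc n) * f n) = f n" for n
        by (simp del: of_nat_Suc flip: mult.assoc)
      ultimately show ?thesis
        by (simp only: mult_zero_left)
    qed
    show ?thesis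
    proof (rule lie_tangent[OF mem filterlim_real_Suc])
      have "of_real (real (Suc n)) * Complex (x n) (y n) = Complex (real (Suc n) * x n) (real (Suc n) * y n)" for n
        by (simp add: complex_eq_iff del: of_nat_Suc)
      then show "(\<lambda>n. of_real (real (Suc n)) * Complex (x n) (y n)) \<longlonglongrightarrow> w"
        using tendsto_Complex[OF lims(1,2)] by (simp only: complex_surj)
      show "(\<lambda>n. Complex (x n) (y n)) \<longlonglongrightarrow> 0"
        using tendsto_Complex[OF to0[OF lims(1)] to0[OF lims(2)]] by (simp flip: zero_complex.code)
    qed (rule lims to0[OF lims(3)] to0[OF lims(4)])+
  qed
  show ?thesis
  proof (rule lie_cases[of n1 n2 n3 n4])
    show "\<exists>l. lie w z d l" if "n1 * Re w + n2 * Im w + n3 * z + n4 * d = 0" for w z d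
      using that by (rule lie_ex)
  next
    fix l
    assume A: "\<And>w. lie w 0 0 0" "lie 0 1 0 l"
    have "M40 \<subseteq> isom_act \<one>\<^bsub>Isom\<^esub> ` isom_orbit G (0, 0, 0, 0)"
    proof
      fix p
      assume "p \<in> M40"
      then have "p \<in> isom_orbit G (0, 0, 0, 0)"
        using subsetD[OF M40_subset_orbit[OF A]] by simp
      moreover have "p = isom_act \<one>\<^bsub>Isom\<^esub> p"
        using isom_act_one[of p] by (simp only: Isom_def monoid.select_convs)
      ultimately show "p \<in> isom_act \<one>\<^bsub>Isom\<^esub> ` isom_orbit G (0, 0, 0, 0)"
        by (rule rev_image_eqI)
    qed
    moreover have "\<one>\<^bsub>Isom\<^esub> \<in> carrier Isom"
      by (rule monoid.one_closed[OF group.is_monoid[OF group_Isom]])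
    ultimately show ?thesis
      by (intro bexI[of _ "\<one>\<^bsub>Isom\<^esub>"] disjI2)
  next
    fix z0 l0
    assume B: "\<And>w. lie w 0 0 0" "lie 0 z0 1 l0"
    from M3_subset_orbit[OF B] show ?thesis by (elim bexE) (rule bexI, rule disjI2, rule disjI2, rule disjI1)
  next
    fix u w0
    assume C: "u \<noteq> 0" "lie u 0 0 0" "lie 0 1 0 0" "lie w0 0 1 0"
    from M2_subset_orbit[OF C] show ?thesis by (elim bexE) (rule bexI, rule disjI2, rule disjI1)
  next
    fix w0
    assume D: "w0 \<noteq> 0" "lie 0 1 0 0" "lie w0 0 1 0" "lie (\<i> * w0) 0 0 1"
    from M1_subset_orbit[OF D] show ?thesis by (elim bexE) (rule bexI, rule disjI1)
  qed
qed

theorem theorem1p2: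
  fixes M :: "R4 set"
  assumes "homogeneous_hypersurface M"
  shows "\<exists>g\<in>carrier Isom.
    (\<exists>r>0. isom_act g ` M = M1 r \<and>
       subgroup H1 Isom \<and>
       Isom\<lparr>carrier := H1\<rparr> \<cong>\<^sub>L semidirect_real (\<lambda>t x. \<theta>1 t * x) \<times>\<times> SO2 \<and>
       M1 r = isom_orbit H1 (tanh r, 0, 0, ln (sech r))) \<or>
    (\<exists>r\<ge>0. isom_act g ` M = M2 r \<and>
       subgroup H2 Sol04 \<and>
       Sol04\<lparr>carrier := H2\<rparr> \<cong>\<^sub>L semidirect_real (\<lambda>t v. \<theta>2 t *v v) \<and>
       M2 r = isom_orbit (left_translations H2) (0, tanh r, 0, ln (sech r))) \<or>
    (\<exists>r\<ge>0. isom_act g ` M = M3 r \<and>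
       subgroup H3 Sol04 \<and>
       Sol04\<lparr>carrier := H3\<rparr> \<cong>\<^sub>L semidirect_real (\<lambda>t v. \<theta>3 t *v v) \<and>
       M3 r = isom_orbit (left_translations H3)
                (0, 0, 1/2 * tanh (2 * r), 1/2 * ln (cosh (2 * r)))) \<or>
    (isom_act g ` M = M40 \<and>
       subgroup H4 Sol04 \<and>
       Sol04\<lparr>carrier := H4\<rparr> \<cong>\<^sub>L additive_R3 \<and>
       M40 = isom_orbit (left_translations H4) (0, 0, 0, 0))"
proof -
  obtain G p where M: "hypersurface M" and G: "subgroup G Isom"
    and closedin: "closedin (top_of_set (carrier Isom)) G" and p: "p \<in> M" and orb: "M = isom_orbit G p"
    using assms unfolding homogeneous_hypersurface_def by blast
  have "closed G"
    using closedin closed_carrier_Isom by (simp add: closedin_closed_eq)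
  with G have G_locale: "closed_isom_subgroup G"
    by (rule closed_isom_subgroup.intro)
  obtain px py pz pt where p_eq: "p = (px, py, pz, pt)"
    by (cases p)
  \<comment> \<open>The inverse of p in the group law.\<close>
  define a where "a = (- exp (-pt) * px, - exp (-pt) * py, - exp (2 * pt) * pz, - pt)"
  define h k :: sol_isometry where "h = (a, mat 1, 1)" and "k = (p, mat 1, 1)"
  have hk_carrier: "h \<in> carrier Isom" "k \<in> carrier Isom"
    by (simp_all add: h_def k_def Isom_def orthogonal_matrix_id)
  have hk: "isom_mult h k = \<one>\<^bsub>Isom\<^esub>"
    by (simp add: h_def k_def Isom_def a_def p_eq)
  have act_h: "isom_act h q = sol_mult a q" for q
    unfolding h_def by (rule isom_act_translation)
  have hp: "isom_act h p = (0, 0, 0, 0)"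
    unfolding act_h by (simp add: a_def p_eq)
  define G' where "G' = isom_conjugate h k G"
  interpret G': closed_isom_subgroup G'
    unfolding G'_def by (rule closed_isom_subgroup_conjugate[OF G_locale hk_carrier hk])
  have orb': "isom_orbit G' (0, 0, 0, 0) = isom_act h ` M"
    using isom_orbit_conjugate[OF subgroup.subset[OF G] hk_carrier hk, of p]
    unfolding hp orb G'_def .
  obtain l :: "R4 \<Rightarrow> real" where l: "linear l"
    and tangent: "\<And>v. l v = 0 \<Longrightarrow> \<exists>q. (\<forall>n. q n \<in> M) \<and> (\<lambda>n. real (Suc n) *\<^sub>R (q n - p)) \<longlonglongrightarrow> v"
    using hypersurface_tangent[OF M p] by blast
  define s where "s = - pt"
  have l_eq: "l (x, y, z, d) = l (1, 0, 0, 0) * x + l (0, 1, 0, 0) * y + l (0, 0, 1, 0) * z + l (0, 0, 0, 1) * d"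
    for x y z d
  proof -
    have "(x, y, z, d) = x *\<^sub>R (1, 0, 0, 0) + y *\<^sub>R (0, 1, 0, 0) + z *\<^sub>R (0, 0, 1, 0) + d *\<^sub>R (0, 0, 0, 1)"
      by simp
    then have "l (x, y, z, d) = x * l (1, 0, 0, 0) + y * l (0, 1, 0, 0) + z * l (0, 0, 1, 0) + d * l (0, 0, 0, 1)"
      by (simp only: linear_add[OF l] linear_scale[OF l] real_scaleR_def)
    then show ?thesis
      by (simp only: mult.commute)
  qed
  \<comment> \<open>Left translation by \<open>a\<close>, whose t-component is \<open>s\<close>, has
    at p the differential with factors exp s, exp s, exp (-2 s), 1. The coefficients are those of
    \<open>l\<close> composed with its inverse, so their kernel consists of the translated tangent
    directions.\<close>
  have "\<forall>x y z d. (l (1, 0, 0, 0) * exp (-s)) * x + (l (0, 1, 0, 0) * exp (-s)) * y +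
        (l (0, 0, 1, 0) * exp (2 * s)) * z + l (0, 0, 0, 1) * d = 0 \<longrightarrow>
      (\<exists>q. (\<forall>n. q n \<in> isom_orbit G' (0, 0, 0, 0)) \<and> (\<lambda>n. real (Suc n) *\<^sub>R q n) \<longlonglongrightarrow> (x, y, z, d))"
  proof (intro allI impI)
    fix x y z d
    assume eq0: "(l (1, 0, 0, 0) * exp (-s)) * x + (l (0, 1, 0, 0) * exp (-s)) * y +
        (l (0, 0, 1, 0) * exp (2 * s)) * z + l (0, 0, 0, 1) * d = 0"
    have "l (exp (-s) * x, exp (-s) * y, exp (2 * s) * z, d) = 0"
      using eq0 unfolding l_eq[of "exp (-s) * x"] by (simp only: mult.assoc)
    from tangent[OF this] obtain q where q: "\<And>n. q n \<in> M"
      and lim: "(\<lambda>n. real (Suc n) *\<^sub>R (q n - p)) \<longlonglongrightarrow> (exp (-s) * x, exp (-s) * y, exp (2 * s) * z, d)"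
      by blast
    define D :: "R4 \<Rightarrow> R4" where "D v = (exp s * fst v, exp s * fst (snd v), exp (-2 * s) * fst (snd (snd v)),
        snd (snd (snd v)))" for v
    have "isom_act h (q n) = D (q n - p)" for n
    proof -
      have "isom_act h (q n) = isom_act h (q n) - isom_act h p"
        unfolding hp by (simp flip: zero_prod_def del: isom_act.simps)
      then show ?thesis
        unfolding act_h sol_mult_diff by (simp add: D_def a_def s_def)
    qed
    then have "real (Suc n) *\<^sub>R isom_act h (q n) = D (real (Suc n) *\<^sub>R (q n - p))" for n
      by (simp add: D_def mult.left_commute del: of_nat_Suc isom_act.simps)
    moreover have "(\<lambda>n. D (real (Suc n) *\<^sub>R (q n - p))) \<longlonglongrightarrow> D (exp (-s) * x, exp (-s) * y, exp (2 * s) * z, d)"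
      unfolding D_def by (intro tendsto_intros lim)
    moreover have "D (exp (-s) * x, exp (-s) * y, exp (2 * s) * z, d) = (x, y, z, d)"
      by (simp add: D_def flip: mult.assoc exp_add)
    ultimately have "(\<lambda>n. real (Suc n) *\<^sub>R isom_act h (q n)) \<longlonglongrightarrow> (x, y, z, d)"
      by (simp only:)
    moreover have "isom_act h (q n) \<in> isom_orbit G' (0, 0, 0, 0)" for n
      unfolding orb' using q by (rule imageI)
    ultimately show "\<exists>q. (\<forall>n. q n \<in> isom_orbit G' (0, 0, 0, 0)) \<and> (\<lambda>n. real (Suc n) *\<^sub>R q n) \<longlonglongrightarrow> (x, y, z, d)"
      by (intro exI[of _ "\<lambda>n. isom_act h (q n)"] conjI allI)
  qed
  from G'.orbit_contains_model[OF this]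
  obtain g' where g': "g' \<in> carrier Isom" and sub:
    "(\<exists>r>0. M1 r \<subseteq> isom_act g' ` isom_act h ` M) \<or>
     (\<exists>r\<ge>0. M2 r \<subseteq> isom_act g' ` isom_act h ` M) \<or>
     (\<exists>r\<ge>0. M3 r \<subseteq> isom_act g' ` isom_act h ` M) \<or>
     M40 \<subseteq> isom_act g' ` isom_act h ` M"
    unfolding orb' by (elim bexE)
  define g where "g = isom_mult g' h"
  have "isom_act g' ` isom_act h ` M = isom_act g ` M"
  proof -
    have "isom_act g = (\<lambda>x. isom_act g' (isom_act h x))"
      by (rule ext) (simp only: g_def isom_act_mult)
    then show ?thesis
      by (simp only: image_image)
  qed
  note sub = sub[unfolded this]
  have "g' \<otimes>\<^bsub>Isom\<^esub> h \<in> carrier Isom"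
    by (intro monoid.m_closed[OF group.is_monoid[OF group_Isom]] g' hk_carrier)
  then have g: "g \<in> carrier Isom"
    by (simp add: g_def Isom_def)
  show ?thesis
  proof (rule bexI[OF _ g])
    show "(\<exists>r>0. isom_act g ` M = M1 r \<and>
       subgroup H1 Isom \<and>
       Isom\<lparr>carrier := H1\<rparr> \<cong>\<^sub>L semidirect_real (\<lambda>t x. \<theta>1 t * x) \<times>\<times> SO2 \<and>
       M1 r = isom_orbit H1 (tanh r, 0, 0, ln (sech r))) \<or>
    (\<exists>r\<ge>0. isom_act g ` M = M2 r \<and>
       subgroup H2 Sol04 \<and>
       Sol04\<lparr>carrier := H2\<rparr> \<cong>\<^sub>L semidirect_real (\<lambda>t v. \<theta>2 t *v v) \<and>
       M2 r = isom_orbit (left_translations H2) (0, tanh r, 0, ln (sech r))) \<or>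
    (\<exists>r\<ge>0. isom_act g ` M = M3 r \<and>
       subgroup H3 Sol04 \<and>
       Sol04\<lparr>carrier := H3\<rparr> \<cong>\<^sub>L semidirect_real (\<lambda>t v. \<theta>3 t *v v) \<and>
       M3 r = isom_orbit (left_translations H3)
                (0, 0, 1/2 * tanh (2 * r), 1/2 * ln (cosh (2 * r)))) \<or>
    (isom_act g ` M = M40 \<and>
       subgroup H4 Sol04 \<and>
       Sol04\<lparr>carrier := H4\<rparr> \<cong>\<^sub>L additive_R3 \<and>
       M40 = isom_orbit (left_translations H4) (0, 0, 0, 0))"
      using sub isom_image_eq_M1[OF M g] isom_image_eq_M2[OF M g] isom_image_eq_M3[OF M g]
        isom_image_eq_M40[OF M g] subgroup_H1 subgroup_H2 subgroup_H3 subgroup_H4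
        lie_isomorphic_H1 lie_isomorphic_H2 lie_isomorphic_H3 lie_isomorphic_H4
        M1_orbit M2_orbit M3_orbit M40_orbit
      by meson
  qed
qed

end
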